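(* If $U$ and $V$ are conditionally independent given $W$, then $$\sigma\left(P_{E_U}P_{E_V\cap E_W}-\Pi\right)=\sigma\left(P_{E_U^{(UW)}}P_{E_W^{(UW)}}-\Pi_{UW}\right)$$ and $$\sigma\left(P_{E_V}P_{E_U\cap E_W}-\Pi\right)=\sigma\left(P_{E_V^{(VW)}}P_{E_W^{(VW)}}-\Pi_{VW}\right).$$
   Context: Let $\mathcal U,\mathcal V,\mathcal W$ be complete separable metric spaces with their Borel $\sigma$-algebras, $\mathcal X=\mathcal U\times\mathcal V\times\mathcal W$, let $\pi$ be a Borel probability measure on $\mathcal X$, and let $(U,V,W)$ be a random element of $\mathcal X$ with distribution $\pi$. $L^2(\pi)$ is the complex Hilbert space of square-integrable functions $\mathcal X\to\mathbb C$ (identified when equal $\pi$-a.e.); $E_U,E_V,E_W$ are the closed subspaces of functions in $L^2(\pi)$ that are constant with respect to the $u$-, $v$-, $w$-coordinate, respectively. Intersections are of functions before a.e. identification: $E_V\cap E_W$ consists of (classes of) functions depending only on $u$, and $E_U\cap E_W$ of functions depending only on $v$. $P_S$ is the orthogonal projection onto the closed subspace $S$; e.g. $P_{E_U}f=\mathbb E[f(U,V,W)\mid V,W]$ and $P_{E_V\cap E_W}f=\mathbb E[f(U,V,W)\mid U]$. $\Pi f$ is the constant function $\int f\,d\pi$. $\pi_{UW}$ and $\pi_{VW}$ are the marginal distributions of $\pi$ on $\mathcal U\times\mathcal W$ and $\mathcal V\times\mathcal W$. $\Pi_{UW}$ on $L^2(\pi_{UW})$ and $\Pi_{VW}$ on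 $L^2(\pi_{VW})$ map a function to the constant function equal to its integral. $E_U^{(UW)}$, $E_W^{(UW)}$ are the closed subspaces of $L^2(\pi_{UW})$ of functions constant with respect to the $u$-, respectively $w$-coordinate, with orthogonal projections $P_{E_U^{(UW)}}$, $P_{E_W^{(UW)}}$ in $L^2(\pi_{UW})$; $E_V^{(VW)}$, $E_W^{(VW)}$ are defined analogously in $L^2(\pi_{VW})$. $\sigma(T)$ is the spectrum of a bounded operator $T$. *)

theory Defs
  imports "HOL-Probability.Probability"
begin

section \<open>The Hilbert space of square-integrable complex functions\<close>

text \<open>
  Since the measure is a term, the space cannot be a type: it is a carrier set of equivalence
  classes, and its operations are functions on classes that are meaningful on that carrier.
\<close>

definition l2_funs :: "'a measure \<Rightarrow> ('a \<Rightarrow> complex) set" where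
  "l2_funs M = {f \<in> borel_measurable M. integrable M (\<lambda>x. (norm (f x))\<^sup>2)}"

definition ae_rel :: "'a measure \<Rightarrow> (('a \<Rightarrow> complex) \<times> ('a \<Rightarrow> complex)) set" where
  "ae_rel M = {(f, g). f \<in> l2_funs M \<and> g \<in> l2_funs M \<and> (AE x in M. f x = g x)}"

definition L2 :: "'a measure \<Rightarrow> ('a \<Rightarrow> complex) set set" where
  "L2 M = l2_funs M // ae_rel M"

definition l2_cls :: "'a measure \<Rightarrow> ('a \<Rightarrow> complex) \<Rightarrow> ('a \<Rightarrow> complex) set" where
  "l2_cls M f = ae_rel M `` {f}"

definition l2_rep :: "('a \<Rightarrow> complex) set \<Rightarrow> 'a \<Rightarrow> complex" where
  "l2_rep X = (SOME f. f \<in> X)"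

text \<open>
  The operations are defined through a chosen representative; their independence of the choice is
  proved below.
\<close>

definition l2_add :: "'a measure \<Rightarrow> ('a \<Rightarrow> complex) set \<Rightarrow> ('a \<Rightarrow> complex) set \<Rightarrow> ('a \<Rightarrow> complex) set" where
  "l2_add M X Y = l2_cls M (\<lambda>x. l2_rep X x + l2_rep Y x)"

definition l2_scale :: "'a measure \<Rightarrow> complex \<Rightarrow> ('a \<Rightarrow> complex) set \<Rightarrow> ('a \<Rightarrow> complex) set" where
  "l2_scale M c X = l2_cls M (\<lambda>x. c * l2_rep X x)"

definition l2_diff :: "'a measure \<Rightarrow> ('a \<Rightarrow> complex) set \<Rightarrow> ('a \<Rightarrow> complex) set \<Rightarrow> ('a \<Rightarrow> complex) set" where
  "l2_diff M X Y = l2_cls M (\<lambda>x. l2_rep X x - l2_rep Y x)"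

definition l2_inner :: "'a measure \<Rightarrow> ('a \<Rightarrow> complex) set \<Rightarrow> ('a \<Rightarrow> complex) set \<Rightarrow> complex" where
  "l2_inner M X Y = (\<integral>x. l2_rep X x * cnj (l2_rep Y x) \<partial>M)"

definition l2_norm :: "'a measure \<Rightarrow> ('a \<Rightarrow> complex) set \<Rightarrow> real" where
  "l2_norm M X = sqrt (\<integral>x. (norm (l2_rep X x))\<^sup>2 \<partial>M)"

lemma equiv_ae_rel: "equiv (l2_funs M) (ae_rel M)"
proof (rule equivI)
  show "ae_rel M \<subseteq> l2_funs M \<times> l2_funs M" by (auto simp: ae_rel_def)
  show "refl_on (l2_funs M) (ae_rel M)" by (auto simp: refl_on_def ae_rel_def)
  show "sym (ae_rel M)" by (auto simp: sym_def ae_rel_def)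
  show "trans (ae_rel M)"
    unfolding trans_def ae_rel_def by auto
qed

lemma l2_cls_in_L2: "f \<in> l2_funs M \<Longrightarrow> l2_cls M f \<in> L2 M"
  by (simp add: L2_def l2_cls_def quotientI)

lemma l2_cls_eq_iff:
  assumes "f \<in> l2_funs M" "g \<in> l2_funs M"
  shows "l2_cls M f = l2_cls M g \<longleftrightarrow> (AE x in M. f x = g x)"
  using eq_equiv_class_iff[OF equiv_ae_rel assms] assms by (simp add: l2_cls_def ae_rel_def)

lemma l2_rep_cls:
  assumes "f \<in> l2_funs M"
  shows "l2_rep (l2_cls M f) \<in> l2_funs M" "AE x in M. l2_rep (l2_cls M f) x = f x"
proof -
  have "f \<in> l2_cls M f" using assms by (auto simp: l2_cls_def ae_rel_def)
  hence "l2_rep (l2_cls M f) \<in> l2_cls M f" unfolding l2_rep_def by (rule someI[of "\<lambda>h. h \<in> l2_cls M f"])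
  thus "l2_rep (l2_cls M f) \<in> l2_funs M" "AE x in M. l2_rep (l2_cls M f) x = f x"
    by (auto simp: l2_cls_def ae_rel_def)
qed

lemma l2_funs_scale: "f \<in> l2_funs M \<Longrightarrow> (\<lambda>x. c * f x) \<in> l2_funs M"
  by (auto simp: l2_funs_def norm_mult power_mult_distrib)

lemma l2_funs_add:
  assumes "f \<in> l2_funs M" "g \<in> l2_funs M"
  shows "(\<lambda>x. f x + g x) \<in> l2_funs M"
proof -
  have [measurable]: "f \<in> borel_measurable M" "g \<in> borel_measurable M"
    using assms by (auto simp: l2_funs_def)
  have "integrable M (\<lambda>x. (norm (f x + g x))\<^sup>2)"
  proof (rule Bochner_Integration.integrable_bound)
    show "integrable M (\<lambda>x. 2 * (norm (f x))\<^sup>2 + 2 * (norm (g x))\<^sup>2)"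
      using assms by (auto simp: l2_funs_def)
    show "AE x in M. norm ((norm (f x + g x))\<^sup>2) \<le> norm (2 * (norm (f x))\<^sup>2 + 2 * (norm (g x))\<^sup>2)"
    proof (rule AE_I2)
      fix x
      have "(norm (f x + g x))\<^sup>2 \<le> (norm (f x) + norm (g x))\<^sup>2"
        by (intro power_mono norm_triangle_ineq) auto
      also have "\<dots> \<le> 2 * (norm (f x))\<^sup>2 + 2 * (norm (g x))\<^sup>2"
        using sum_squares_bound[of "norm (f x)" "norm (g x)"] by (simp add: power2_sum)
      finally show "norm ((norm (f x + g x))\<^sup>2) \<le> norm (2 * (norm (f x))\<^sup>2 + 2 * (norm (g x))\<^sup>2)"
        by simp
    qed
  qed measurable
  thus ?thesis by (simp add: l2_funs_def)
qed

lemma l2_funs_diff: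
  assumes "f \<in> l2_funs M" "g \<in> l2_funs M"
  shows "(\<lambda>x. f x - g x) \<in> l2_funs M"
  using l2_funs_add[OF assms(1) l2_funs_scale[OF assms(2), of "-1"]] by simp

lemma l2_add_cls:
  assumes "f \<in> l2_funs M" "g \<in> l2_funs M"
  shows "l2_add M (l2_cls M f) (l2_cls M g) = l2_cls M (\<lambda>x. f x + g x)"
  unfolding l2_add_def using assms l2_rep_cls[OF assms(1)] l2_rep_cls[OF assms(2)]
  by (subst l2_cls_eq_iff) (auto intro: l2_funs_add)

lemma l2_diff_cls:
  assumes "f \<in> l2_funs M" "g \<in> l2_funs M"
  shows "l2_diff M (l2_cls M f) (l2_cls M g) = l2_cls M (\<lambda>x. f x - g x)"
  unfolding l2_diff_def using assms l2_rep_cls[OF assms(1)] l2_rep_cls[OF assms(2)]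
  by (subst l2_cls_eq_iff) (auto intro: l2_funs_diff)

lemma l2_scale_cls:
  assumes "f \<in> l2_funs M"
  shows "l2_scale M c (l2_cls M f) = l2_cls M (\<lambda>x. c * f x)"
  unfolding l2_scale_def using assms l2_rep_cls[OF assms(1)]
  by (subst l2_cls_eq_iff) (auto intro: l2_funs_scale)

lemma l2_inner_cls:
  assumes "f \<in> l2_funs M" "g \<in> l2_funs M"
  shows "l2_inner M (l2_cls M f) (l2_cls M g) = (\<integral>x. f x * cnj (g x) \<partial>M)"
proof -
  have [measurable]: "cnj \<in> borel_measurable borel"
    by (intro borel_measurable_continuous_onI continuous_intros)
  have [measurable]: "f \<in> borel_measurable M" "g \<in> borel_measurable M"
    "l2_rep (l2_cls M f) \<in> borel_measurable M" "l2_rep (l2_cls M g) \<in> borel_measurable M"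
    using assms l2_rep_cls[OF assms(1)] l2_rep_cls[OF assms(2)] by (auto simp: l2_funs_def)
  show ?thesis
    unfolding l2_inner_def using l2_rep_cls(2)[OF assms(1)] l2_rep_cls(2)[OF assms(2)]
    by (intro integral_cong_AE) auto
qed

lemma l2_norm_cls:
  assumes "f \<in> l2_funs M"
  shows "l2_norm M (l2_cls M f) = sqrt (\<integral>x. (norm (f x))\<^sup>2 \<partial>M)"
proof -
  have [measurable]: "f \<in> borel_measurable M" "l2_rep (l2_cls M f) \<in> borel_measurable M"
    using assms l2_rep_cls[OF assms(1)] by (auto simp: l2_funs_def)
  have "(\<integral>x. (norm (l2_rep (l2_cls M f) x))\<^sup>2 \<partial>M) = (\<integral>x. (norm (f x))\<^sup>2 \<partial>M)"
    using l2_rep_cls(2)[OF assms(1)] by (intro integral_cong_AE) auto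
  thus ?thesis by (simp add: l2_norm_def)
qed


section \<open>Operators\<close>

definition l2_proj ::
  "'a measure \<Rightarrow> ('a \<Rightarrow> complex) set set \<Rightarrow> ('a \<Rightarrow> complex) set \<Rightarrow> ('a \<Rightarrow> complex) set" where
  "l2_proj M S X = (THE Y. Y \<in> S \<and> (\<forall>Z\<in>S. l2_inner M (l2_diff M X Y) Z = 0))"

definition l2_mean :: "'a measure \<Rightarrow> ('a \<Rightarrow> complex) set \<Rightarrow> ('a \<Rightarrow> complex) set" where
  "l2_mean M X = l2_cls M (\<lambda>_. \<integral>x. l2_rep X x \<partial>M)"

lemma l2_mean_cls:
  assumes "f \<in> l2_funs M"
  shows "l2_mean M (l2_cls M f) = l2_cls M (\<lambda>_. \<integral>x. f x \<partial>M)"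
proof -
  have "(\<integral>x. l2_rep (l2_cls M f) x \<partial>M) = (\<integral>x. f x \<partial>M)"
    using assms l2_rep_cls[OF assms] by (intro integral_cong_AE) (auto simp: l2_funs_def)
  thus ?thesis by (simp add: l2_mean_def)
qed

definition l2_op_diff ::
  "'a measure \<Rightarrow> (('a \<Rightarrow> complex) set \<Rightarrow> ('a \<Rightarrow> complex) set) \<Rightarrow>
   (('a \<Rightarrow> complex) set \<Rightarrow> ('a \<Rightarrow> complex) set) \<Rightarrow> ('a \<Rightarrow> complex) set \<Rightarrow> ('a \<Rightarrow> complex) set" where
  "l2_op_diff M A B X = l2_diff M (A X) (B X)"

definition l2_bounded_op :: "'a measure \<Rightarrow> (('a \<Rightarrow> complex) set \<Rightarrow> ('a \<Rightarrow> complex) set) \<Rightarrow> bool" where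
  "l2_bounded_op M T \<longleftrightarrow>
     (\<forall>X\<in>L2 M. T X \<in> L2 M) \<and>
     (\<forall>X\<in>L2 M. \<forall>Y\<in>L2 M. T (l2_add M X Y) = l2_add M (T X) (T Y)) \<and>
     (\<forall>c. \<forall>X\<in>L2 M. T (l2_scale M c X) = l2_scale M c (T X)) \<and>
     (\<exists>C. \<forall>X\<in>L2 M. l2_norm M (T X) \<le> C * l2_norm M X)"

definition l2_spectrum :: "'a measure \<Rightarrow> (('a \<Rightarrow> complex) set \<Rightarrow> ('a \<Rightarrow> complex) set) \<Rightarrow> complex set" where
  "l2_spectrum M T =
     {c. \<not> (\<exists>R. l2_bounded_op M R \<and>
            (\<forall>X\<in>L2 M. R (l2_op_diff M T (l2_scale M c) X) = X \<and>
                      l2_op_diff M T (l2_scale M c) (R X) = X))}"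


section \<open>Functions that are constant in a coordinate\<close>

text \<open>
  These are sets of functions, not of classes, so that intersections can be formed before
  almost-everywhere identification; \<open>l2_sub\<close> then passes to classes.
\<close>

definition const_u :: "('u \<times> 'v \<times> 'w \<Rightarrow> complex) set" where
  "const_u = {f. \<forall>u u' v w. f (u, v, w) = f (u', v, w)}"

definition const_v :: "('u \<times> 'v \<times> 'w \<Rightarrow> complex) set" where
  "const_v = {f. \<forall>u v v' w. f (u, v, w) = f (u, v', w)}"

definition const_w :: "('u \<times> 'v \<times> 'w \<Rightarrow> complex) set" where
  "const_w = {f. \<forall>u v w w'. f (u, v, w) = f (u, v, w')}"

definition const_fst :: "('a \<times> 'b \<Rightarrow> complex) set" where
  "const_fst = {f. \<forall>a a' b. f (a, b) = f (a', b)}"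

definition const_snd :: "('a \<times> 'b \<Rightarrow> complex) set" where
  "const_snd = {f. \<forall>a b b'. f (a, b) = f (a, b')}"

definition l2_sub :: "'a measure \<Rightarrow> ('a \<Rightarrow> complex) set \<Rightarrow> ('a \<Rightarrow> complex) set set" where
  "l2_sub M F = l2_cls M ` (F \<inter> l2_funs M)"


section \<open>Marginals and conditional independence\<close>

definition marginal_uw ::
  "('u::topological_space \<times> 'v::topological_space \<times> 'w::topological_space) measure \<Rightarrow> ('u \<times> 'w) measure" where
  "marginal_uw \<pi> = distr \<pi> borel (\<lambda>(u, v, w). (u, w))"

definition marginal_vw ::
  "('u::topological_space \<times> 'v::topological_space \<times> 'w::topological_space) measure \<Rightarrow> ('v \<times> 'w) measure" where
  "marginal_vw \<pi> = distr \<pi> borel (\<lambda>(u, v, w). (v, w))"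

definition cond_indep_given ::
  "'p measure \<Rightarrow> ('p \<Rightarrow> 'u::topological_space) \<Rightarrow> ('p \<Rightarrow> 'v::topological_space) \<Rightarrow>
   ('p \<Rightarrow> 'w::topological_space) \<Rightarrow> bool" where
  "cond_indep_given M U V W \<longleftrightarrow>
     (let \<G> = vimage_algebra (space M) W borel in
      \<forall>A\<in>sets borel. \<forall>B\<in>sets borel. AE \<omega> in M.
        real_cond_exp M \<G> (\<lambda>\<omega>. indicator A (U \<omega>) * indicator B (V \<omega>)) \<omega> =
        real_cond_exp M \<G> (\<lambda>\<omega>. indicator A (U \<omega>)) \<omega> *
        real_cond_exp M \<G> (\<lambda>\<omega>. indicator B (V \<omega>)) \<omega>)"

end

theory Submission
  imports Defs
begin

text \<open>
  Let \<open>J\<close> be the isometry \<open>g \<mapsto> g(U, W)\<close> from \<open>L\<^sup>2(\<pi>\<^sub>U\<^sub>W)\<close> into \<open>L\<^sup>2(\<pi>)\<close>. Conditional independence gives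
  \<open>\<E>[a(U) | V, W] = \<E>[a(U) | W]\<close>, so the operator \<open>T\<close> on \<open>L\<^sup>2(\<pi>)\<close> has range in that of \<open>J\<close> and satisfies
  \<open>T J = J T'\<close>, where \<open>T'\<close> is the operator on \<open>L\<^sup>2(\<pi>\<^sub>U\<^sub>W)\<close>. Hence \<open>T = J S\<close> and \<open>T' = S J\<close> for a bounded
  \<open>S\<close>, and the spectra agree away from 0. Both contain 0, because subtracting the mean makes
  the constants a nontrivial kernel; so it does not matter that \<open>J\<close> need not be onto.
\<close>

section \<open>Bounded linear maps between \<open>L\<^sup>2\<close>-spaces\<close>

text \<open>A projection is specified only by orthogonality, through a definite description, and its
  subspace consists of classes of functions that are constant on the fibres of a coordinate map
  everywhere, not merely almost everywhere. Existence, uniqueness and boundedness must therefore be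
  obtained with such representatives. Conditional expectations supply them: measurability for the
  sigma-algebra generated by the map already forces exact constancy on its fibres.

  The hypothesis speaks of indicators of one event in U and one in V. Dynkin's argument extends it
  to events of the pair (V, W). The passage from events in U to unbounded a(U) avoids approximation:
  for an indicator I of an event of (V, W), the difference I - E[I | W] is orthogonal to all events
  in U, so its conditional expectation given U vanishes and a(U) can be pulled out.

  The spectral comparison away from 0 rests on an explicit formula that turns an inverse of SJ - c
  into one of JS - c. It divides by c, which is why 0 is treated apart.\<close>

lemma L2_cases:
  assumes "X \<in> L2 M"
  obtains f where "f \<in> l2_funs M" "X = l2_cls M f"
  using assms unfolding L2_def l2_cls_def by (auto elim: quotientE)

section \<open>Vector space arithmetic and norms of classes\<close>

lemma l2_add_in_L2: "X \<in> L2 M \<Longrightarrow> Y \<in> L2 M \<Longrightarrow> l2_add M X Y \<in> L2 M"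
  by (auto elim!: L2_cases simp: l2_add_cls l2_cls_in_L2 l2_funs_add)

lemma l2_diff_in_L2: "X \<in> L2 M \<Longrightarrow> Y \<in> L2 M \<Longrightarrow> l2_diff M X Y \<in> L2 M"
  by (auto elim!: L2_cases simp: l2_diff_cls l2_cls_in_L2 l2_funs_diff)

lemma l2_scale_in_L2: "X \<in> L2 M \<Longrightarrow> l2_scale M c X \<in> L2 M"
  by (auto elim!: L2_cases simp: l2_scale_cls l2_cls_in_L2 l2_funs_scale)

lemmas L2_closed = l2_add_in_L2 l2_diff_in_L2 l2_scale_in_L2

lemma l2_funs_uminus: "f \<in> l2_funs M \<Longrightarrow> (\<lambda>x. - f x) \<in> l2_funs M"
  using l2_funs_scale[of f M "- 1"] by simp

lemmas l2_cls_ops = l2_add_cls l2_diff_cls l2_scale_cls l2_funs_add l2_funs_diff l2_funs_scale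
  l2_funs_uminus l2_cls_in_L2

lemma l2_diff_conv_add:
  "X \<in> L2 M \<Longrightarrow> Y \<in> L2 M \<Longrightarrow> l2_diff M X Y = l2_add M X (l2_scale M (- 1) Y)"
  by (auto elim!: L2_cases simp: l2_cls_ops)

lemma l2_add_diff_swap:
  "X \<in> L2 M \<Longrightarrow> X' \<in> L2 M \<Longrightarrow> Y \<in> L2 M \<Longrightarrow> Y' \<in> L2 M \<Longrightarrow>
    l2_diff M (l2_add M X X') (l2_add M Y Y') = l2_add M (l2_diff M X Y) (l2_diff M X' Y')"
  by (auto elim!: L2_cases simp: l2_cls_ops algebra_simps)

lemma l2_scale_diff:
  "X \<in> L2 M \<Longrightarrow> Y \<in> L2 M \<Longrightarrow>
    l2_scale M c (l2_diff M X Y) = l2_diff M (l2_scale M c X) (l2_scale M c Y)"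
  by (auto elim!: L2_cases simp: l2_cls_ops algebra_simps)

lemma l2_scale_add:
  "X \<in> L2 M \<Longrightarrow> Y \<in> L2 M \<Longrightarrow>
    l2_scale M c (l2_add M X Y) = l2_add M (l2_scale M c X) (l2_scale M c Y)"
  by (auto elim!: L2_cases simp: l2_cls_ops algebra_simps)

lemma l2_scale_scale:
  "X \<in> L2 M \<Longrightarrow> l2_scale M a (l2_scale M b X) = l2_scale M (a * b) X"
  by (auto elim!: L2_cases simp: l2_cls_ops algebra_simps)

lemma l2_scale_one: "X \<in> L2 M \<Longrightarrow> l2_scale M 1 X = X"
  by (auto elim!: L2_cases simp: l2_cls_ops)

lemma l2_diff_add_cancel:
  "X \<in> L2 M \<Longrightarrow> Y \<in> L2 M \<Longrightarrow> l2_add M (l2_diff M X Y) Y = X"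
  by (auto elim!: L2_cases simp: l2_cls_ops)

lemma l2_diff_diff_cancel:
  "X \<in> L2 M \<Longrightarrow> Y \<in> L2 M \<Longrightarrow> l2_diff M X (l2_diff M X Y) = Y"
  by (auto elim!: L2_cases simp: l2_cls_ops)

lemma l2_norm_nonneg: "0 \<le> l2_norm M X"
  by (simp add: l2_norm_def)

lemma l2_norm_scale: "X \<in> L2 M \<Longrightarrow> l2_norm M (l2_scale M c X) = norm c * l2_norm M X"
  by (auto elim!: L2_cases simp: l2_cls_ops l2_norm_cls norm_mult power_mult_distrib real_sqrt_mult)

text \<open>The constant 2 makes the estimate elementary; only boundedness of operators matters.\<close>

lemma l2_norm_add_le:
  assumes "X \<in> L2 M" "Y \<in> L2 M"
  shows "l2_norm M (l2_add M X Y) \<le> 2 * (l2_norm M X + l2_norm M Y)"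
proof -
  obtain f g where f: "f \<in> l2_funs M" "X = l2_cls M f" and g: "g \<in> l2_funs M" "Y = l2_cls M g"
    using assms by (auto elim!: L2_cases)
  define a b where "a = (\<integral>x. (norm (f x))\<^sup>2 \<partial>M)" and "b = (\<integral>x. (norm (g x))\<^sup>2 \<partial>M)"
  have nn: "a \<ge> 0" "b \<ge> 0" by (simp_all add: a_def b_def)
  have "(\<integral>x. (norm (f x + g x))\<^sup>2 \<partial>M) \<le> (\<integral>x. 2 * (norm (f x))\<^sup>2 + 2 * (norm (g x))\<^sup>2 \<partial>M)"
  proof (rule integral_mono)
    fix x
    have "(norm (f x + g x))\<^sup>2 \<le> (norm (f x) + norm (g x))\<^sup>2"
      by (intro power_mono norm_triangle_ineq) auto
    also have "\<dots> \<le> 2 * (norm (f x))\<^sup>2 + 2 * (norm (g x))\<^sup>2"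
      using sum_squares_bound[of "norm (f x)" "norm (g x)"] by (simp add: power2_sum)
    finally show "(norm (f x + g x))\<^sup>2 \<le> 2 * (norm (f x))\<^sup>2 + 2 * (norm (g x))\<^sup>2" .
  qed (use f(1) g(1) l2_funs_add[OF f(1) g(1)] in \<open>auto simp: l2_funs_def\<close>)
  also have "\<dots> = 2 * a + 2 * b"
    using f(1) g(1) by (simp add: a_def b_def l2_funs_def)
  also have "\<dots> \<le> (2 * (sqrt a + sqrt b))\<^sup>2"
    using nn mult_nonneg_nonneg[of "sqrt a" "sqrt b"]
    by (simp add: power_mult_distrib power2_sum distrib_left)
  finally have "sqrt (\<integral>x. (norm (f x + g x))\<^sup>2 \<partial>M) \<le> 2 * (sqrt a + sqrt b)"
    using nn by (intro real_le_lsqrt) auto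
  thus ?thesis
    using f g by (simp add: l2_cls_ops l2_norm_cls a_def b_def)
qed

section \<open>Bounded linear maps from one space to another\<close>

text \<open>The two-space form of \<open>l2_bounded_op\<close>: the embedding of the marginal space
  and its partial inverse connect different spaces.\<close>

definition l2_bounded_map ::
  "'a measure \<Rightarrow> 'b measure \<Rightarrow> (('a \<Rightarrow> complex) set \<Rightarrow> ('b \<Rightarrow> complex) set) \<Rightarrow> bool" where
  "l2_bounded_map M N A \<longleftrightarrow>
     (\<forall>X\<in>L2 M. A X \<in> L2 N) \<and>
     (\<forall>X\<in>L2 M. \<forall>Y\<in>L2 M. A (l2_add M X Y) = l2_add N (A X) (A Y)) \<and>
     (\<forall>c. \<forall>X\<in>L2 M. A (l2_scale M c X) = l2_scale N c (A X)) \<and>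
     (\<exists>C. \<forall>X\<in>L2 M. l2_norm N (A X) \<le> C * l2_norm M X)"

lemma l2_bounded_op_iff_map: "l2_bounded_op M A \<longleftrightarrow> l2_bounded_map M M A"
  by (simp add: l2_bounded_op_def l2_bounded_map_def)

lemma l2_bounded_mapI:
  assumes "\<And>X. X \<in> L2 M \<Longrightarrow> A X \<in> L2 N"
    and "\<And>X Y. X \<in> L2 M \<Longrightarrow> Y \<in> L2 M \<Longrightarrow> A (l2_add M X Y) = l2_add N (A X) (A Y)"
    and "\<And>c X. X \<in> L2 M \<Longrightarrow> A (l2_scale M c X) = l2_scale N c (A X)"
    and "\<And>X. X \<in> L2 M \<Longrightarrow> l2_norm N (A X) \<le> C * l2_norm M X"
  shows "l2_bounded_map M N A"
  using assms unfolding l2_bounded_map_def by blast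

lemma l2_bounded_mapD:
  assumes "l2_bounded_map M N A"
  shows "X \<in> L2 M \<Longrightarrow> A X \<in> L2 N"
    and "X \<in> L2 M \<Longrightarrow> Y \<in> L2 M \<Longrightarrow> A (l2_add M X Y) = l2_add N (A X) (A Y)"
    and "X \<in> L2 M \<Longrightarrow> A (l2_scale M c X) = l2_scale N c (A X)"
    and "X \<in> L2 M \<Longrightarrow> Y \<in> L2 M \<Longrightarrow> A (l2_diff M X Y) = l2_diff N (A X) (A Y)"
  using assms by (auto simp: l2_bounded_map_def l2_diff_conv_add L2_closed)

text \<open>The definition leaves the sign of the bound open. Composition multiplies bounds, and
  monotonicity of that product asks for a nonnegative factor.\<close>

lemma l2_bounded_map_bound:
  assumes "l2_bounded_map M N A"
  obtains C where "C \<ge> 0" "\<And>X. X \<in> L2 M \<Longrightarrow> l2_norm N (A X) \<le> C * l2_norm M X"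
proof -
  obtain C where C: "\<And>X. X \<in> L2 M \<Longrightarrow> l2_norm N (A X) \<le> C * l2_norm M X"
    using assms unfolding l2_bounded_map_def by blast
  have "l2_norm N (A X) \<le> \<bar>C\<bar> * l2_norm M X" if "X \<in> L2 M" for X
    by (rule order_trans[OF C[OF that] mult_right_mono[OF abs_ge_self l2_norm_nonneg]])
  thus thesis by (intro that[of "\<bar>C\<bar>"]) auto
qed

lemma l2_bounded_map_id: "l2_bounded_map M M (\<lambda>X. X)"
  by (rule l2_bounded_mapI[where C = 1]) auto

lemma l2_bounded_map_comp:
  assumes A: "l2_bounded_map M N A" and B: "l2_bounded_map N K B"
  shows "l2_bounded_map M K (\<lambda>X. B (A X))"
proof -
  obtain C D where C: "C \<ge> 0" "\<And>X. X \<in> L2 M \<Longrightarrow> l2_norm N (A X) \<le> C * l2_norm M X"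
    and D: "D \<ge> 0" "\<And>X. X \<in> L2 N \<Longrightarrow> l2_norm K (B X) \<le> D * l2_norm N X"
    using l2_bounded_map_bound[OF A] l2_bounded_map_bound[OF B] by metis
  show ?thesis
  proof (rule l2_bounded_mapI[where C = "D * C"])
    fix X assume "X \<in> L2 M"
    thus "l2_norm K (B (A X)) \<le> D * C * l2_norm M X"
      using D(2)[of "A X"] mult_left_mono[OF C(2) D(1)] l2_bounded_mapD(1)[OF A]
      by (fastforce simp: mult.assoc)
  qed (simp_all add: l2_bounded_mapD[OF A] l2_bounded_mapD[OF B])
qed

lemma l2_bounded_map_scale:
  assumes A: "l2_bounded_map M N A"
  shows "l2_bounded_map M N (\<lambda>X. l2_scale N c (A X))"
proof -
  obtain C where C: "\<And>X. X \<in> L2 M \<Longrightarrow> l2_norm N (A X) \<le> C * l2_norm M X"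
    using l2_bounded_map_bound[OF A] by metis
  show ?thesis
  proof (rule l2_bounded_mapI[where C = "norm c * C"])
    fix X assume "X \<in> L2 M"
    thus "l2_norm N (l2_scale N c (A X)) \<le> norm c * C * l2_norm M X"
      using mult_left_mono[OF C, of X "norm c"] l2_bounded_mapD(1)[OF A]
      by (simp add: l2_norm_scale mult.assoc)
  qed (simp_all add: l2_bounded_mapD[OF A] L2_closed l2_scale_add l2_scale_scale mult.commute)
qed

lemma l2_bounded_map_diff:
  assumes A: "l2_bounded_map M N A" and B: "l2_bounded_map M N B"
  shows "l2_bounded_map M N (\<lambda>X. l2_diff N (A X) (B X))"
proof -
  \<comment> \<open>Subtraction is addition of the multiple by -1, so \<open>l2_norm_add_le\<close>
    applies; its factor 2 reappears in the bound below.\<close>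
  note B' = l2_bounded_map_scale[OF B, of "- 1"]
  obtain C D where C: "\<And>X. X \<in> L2 M \<Longrightarrow> l2_norm N (A X) \<le> C * l2_norm M X"
    and D: "\<And>X. X \<in> L2 M \<Longrightarrow> l2_norm N (l2_scale N (- 1) (B X)) \<le> D * l2_norm M X"
    using l2_bounded_map_bound[OF A] l2_bounded_map_bound[OF B'] by metis
  show ?thesis
  proof (rule l2_bounded_mapI[where C = "2 * (C + D)"])
    fix X assume X: "X \<in> L2 M"
    have "l2_norm N (l2_diff N (A X) (B X)) \<le>
        2 * (l2_norm N (A X) + l2_norm N (l2_scale N (- 1) (B X)))"
      using l2_norm_add_le[OF l2_bounded_mapD(1)[OF A X] l2_bounded_mapD(1)[OF B' X]] X
      by (simp add: l2_diff_conv_add l2_bounded_mapD[OF A] l2_bounded_mapD[OF B])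
    thus "l2_norm N (l2_diff N (A X) (B X)) \<le> 2 * (C + D) * l2_norm M X"
      using C[OF X] D[OF X] by (simp add: algebra_simps)
  qed (simp_all add: l2_bounded_mapD[OF A] l2_bounded_mapD[OF B] L2_closed l2_add_diff_swap
      l2_scale_diff)
qed


section \<open>Spectra of products and of intertwined operators\<close>

text \<open>Names the bounded two-sided inverse of T - c, so that an inverse for one operator can be
  converted explicitly into an inverse for another.\<close>

definition l2_resolvent ::
  "'a measure \<Rightarrow> (('a \<Rightarrow> complex) set \<Rightarrow> ('a \<Rightarrow> complex) set) \<Rightarrow> complex \<Rightarrow>
   (('a \<Rightarrow> complex) set \<Rightarrow> ('a \<Rightarrow> complex) set) \<Rightarrow> bool" where
  "l2_resolvent M T c R \<longleftrightarrow> l2_bounded_map M M R \<and>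
     (\<forall>X\<in>L2 M. R (l2_diff M (T X) (l2_scale M c X)) = X \<and>
               l2_diff M (T (R X)) (l2_scale M c (R X)) = X)"

lemma l2_spectrum_iff: "c \<in> l2_spectrum M T \<longleftrightarrow> (\<nexists>R. l2_resolvent M T c R)"
  by (auto simp: l2_spectrum_def l2_resolvent_def l2_bounded_op_iff_map l2_op_diff_def)

text \<open>Operators are total functions on sets of functions but carry meaning only on
  \<open>L2 M\<close>. Factorisations such as T = J S hold only there, and this lemma makes that
  enough.\<close>

lemma l2_spectrum_cong:
  assumes "\<And>X. X \<in> L2 M \<Longrightarrow> T X = T' X"
  shows "l2_spectrum M T = l2_spectrum M T'"
proof -
  have "l2_resolvent M T c R \<longleftrightarrow> l2_resolvent M T' c R" for c R
    using assms by (auto simp: l2_resolvent_def l2_bounded_mapD)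
  thus ?thesis by (auto simp: l2_spectrum_iff)
qed

text \<open>An operator that takes the same value at two distinct classes has no left
  inverse.\<close>

lemma l2_spectrum_zero:
  assumes "X \<in> L2 M" "Y \<in> L2 M" "X \<noteq> Y" "T X \<in> L2 M" "T X = T Y"
  shows "0 \<in> l2_spectrum M T"
proof -
  have "l2_diff M (T X) (l2_scale M 0 X) = l2_diff M (T Y) (l2_scale M 0 Y)"
    using assms by (auto elim!: L2_cases simp: l2_cls_ops)
  thus ?thesis
    using assms(1-3) unfolding l2_spectrum_iff l2_resolvent_def by metis
qed

text \<open>The formula is (AB - c)^(-1) = (1/c) (A (BA - c)^(-1) B - 1). It is suggested by the
  formal geometric series of (c - AB)^(-1), in which (AB)^(n+1) = A (BA)^n B; the verification is
  purely algebraic.\<close>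

lemma l2_resolvent_commute:
  assumes A: "l2_bounded_map N M A" and B: "l2_bounded_map M N B" and "c \<noteq> 0"
    and R': "l2_resolvent N (\<lambda>Y. B (A Y)) c R'"
  shows "l2_resolvent M (\<lambda>X. A (B X)) c (\<lambda>X. l2_scale M (1 / c) (l2_diff M (A (R' (B X))) X))"
    (is "l2_resolvent M _ c ?R")
proof -
  have bR': "l2_bounded_map N N R'"
    and inv1: "\<And>Y. Y \<in> L2 N \<Longrightarrow> R' (l2_diff N (B (A Y)) (l2_scale N c Y)) = Y"
    and inv2: "\<And>Y. Y \<in> L2 N \<Longrightarrow> l2_diff N (B (A (R' Y))) (l2_scale N c (R' Y)) = Y"
    using R' by (auto simp: l2_resolvent_def)
  note D = l2_bounded_mapD[OF A] l2_bounded_mapD[OF B] l2_bounded_mapD[OF bR'] L2_closed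
  have "l2_bounded_map M M ?R"
    by (intro l2_bounded_map_scale l2_bounded_map_diff l2_bounded_map_id
        l2_bounded_map_comp[OF l2_bounded_map_comp[OF B bR'] A])
  moreover have "?R (l2_diff M (A (B X)) (l2_scale M c X)) = X" if X: "X \<in> L2 M" for X
  proof -
    \<comment> \<open>The relation B (AB - c) = (BA - c) B lets \<open>R'\<close> cancel on the
      left.\<close>
    have "B (l2_diff M (A (B X)) (l2_scale M c X)) = l2_diff N (B (A (B X))) (l2_scale N c (B X))"
      using X by (simp add: D)
    hence "R' (B (l2_diff M (A (B X)) (l2_scale M c X))) = B X"
      using X by (simp add: l2_bounded_mapD(1)[OF B] inv1)
    thus ?thesis
      using X \<open>c \<noteq> 0\<close> by (simp add: D l2_diff_diff_cancel l2_scale_scale l2_scale_one)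
  qed
  moreover have "l2_diff M (A (B (?R X))) (l2_scale M c (?R X)) = X" if X: "X \<in> L2 M" for X
  proof -
    define Z where "Z = R' (B X)"
    have Z: "Z \<in> L2 N" using X by (simp add: Z_def D)
    \<comment> \<open>This is (BA - c) Z = B X solved for B A Z. Applying A yields A B A Z - A B X =
      c A Z, so AB maps the candidate \<open>?R X\<close> to A Z, while c times the candidate is A Z
      - X.\<close>
    have "B (A Z) = l2_add N (B X) (l2_scale N c Z)"
      using inv2[of "B X"] l2_diff_add_cancel[of "B (A Z)" N "l2_scale N c Z"] X Z
      by (simp add: D flip: Z_def)
    hence "A (B (A Z)) = l2_add M (A (B X)) (l2_scale M c (A Z))"
      using X Z by (simp add: D)
    hence "A (B (?R X)) = l2_scale M (1 / c)
        (l2_diff M (l2_add M (A (B X)) (l2_scale M c (A Z))) (A (B X)))"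
      using X Z by (simp add: D flip: Z_def)
    also have "\<dots> = A Z"
    proof -
      have "l2_scale M (1 / c) (l2_diff M (l2_add M P (l2_scale M c Q)) P) = Q"
        if "P \<in> L2 M" "Q \<in> L2 M" for P Q
        using that \<open>c \<noteq> 0\<close> by (auto elim!: L2_cases simp: l2_cls_ops)
      thus ?thesis using X Z by (simp add: D)
    qed
    finally show ?thesis
      using X Z \<open>c \<noteq> 0\<close>
      by (simp add: D l2_scale_scale l2_scale_one l2_diff_diff_cancel flip: Z_def)
  qed
  ultimately show ?thesis by (simp add: l2_resolvent_def)
qed

lemma l2_spectrum_commute:
  assumes "l2_bounded_map N M A" "l2_bounded_map M N B"
  shows "l2_spectrum M (\<lambda>X. A (B X)) - {0} = l2_spectrum N (\<lambda>Y. B (A Y)) - {0}"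
  using l2_resolvent_commute[OF assms] l2_resolvent_commute[OF assms(2,1)]
  unfolding l2_spectrum_iff set_eq_iff Diff_iff singleton_iff by blast

text \<open>With \<open>S = J\<inverse> T\<close> one has \<open>T = J S\<close> and \<open>T' = S J\<close>.\<close>

lemma l2_spectrum_intertwined:
  assumes J: "l2_bounded_map N M J"
    and isom: "\<And>Y. Y \<in> L2 N \<Longrightarrow> l2_norm M (J Y) = l2_norm N Y"
    and inj: "inj_on J (L2 N)"
    and T: "l2_bounded_map M M T"
    and T': "l2_bounded_map N N T'"
    and TJ: "\<And>Y. Y \<in> L2 N \<Longrightarrow> T (J Y) = J (T' Y)"
    and range: "\<And>X. X \<in> L2 M \<Longrightarrow> T X \<in> J ` L2 N"
    and zero: "0 \<in> l2_spectrum M T" "0 \<in> l2_spectrum N T'"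
  shows "l2_spectrum M T = l2_spectrum N T'"
proof -
  define S where "S = (\<lambda>X. inv_into (L2 N) J (T X))"
  have S: "S X \<in> L2 N" "J (S X) = T X" if "X \<in> L2 M" for X
    using range[OF that] by (auto simp: S_def inv_into_into f_inv_into_f)
  note D = l2_bounded_mapD[OF J] l2_bounded_mapD[OF T] l2_bounded_mapD[OF T'] L2_closed
  obtain C where C: "\<And>X. X \<in> L2 M \<Longrightarrow> l2_norm M (T X) \<le> C * l2_norm M X"
    using l2_bounded_map_bound[OF T] by metis
  have "l2_bounded_map M N S"
  proof (rule l2_bounded_mapI[where C = C])
    \<comment> \<open>S is given only as a preimage, so identities for it are checked after applying
      the injective J. Its bound is that of T, because J preserves norms.\<close>
    show "S (l2_add M X Y) = l2_add N (S X) (S Y)" if "X \<in> L2 M" "Y \<in> L2 M" for X Y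
      by (rule inj_onD[OF inj]) (use that in \<open>simp_all add: S D\<close>)
    show "S (l2_scale M c X) = l2_scale N c (S X)" if "X \<in> L2 M" for c X
      by (rule inj_onD[OF inj]) (use that in \<open>simp_all add: S D\<close>)
    show "l2_norm N (S X) \<le> C * l2_norm M X" if "X \<in> L2 M" for X
      using C[OF that] isom[of "S X"] S[OF that] by simp
  qed (rule S(1))
  from l2_spectrum_commute[OF J this]
  have "l2_spectrum M (\<lambda>X. J (S X)) - {0} = l2_spectrum N (\<lambda>Y. S (J Y)) - {0}" .
  moreover have "l2_spectrum M (\<lambda>X. J (S X)) = l2_spectrum M T"
    by (rule l2_spectrum_cong) (simp add: S)
  moreover have "l2_spectrum N (\<lambda>Y. S (J Y)) = l2_spectrum N T'"
  proof (rule l2_spectrum_cong)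
    fix Y assume "Y \<in> L2 N"
    thus "S (J Y) = T' Y"
      by (intro inj_onD[OF inj]) (simp_all add: S D TJ)
  qed
  ultimately show ?thesis using zero by blast
qed


section \<open>Projections onto functions that are constant on fibres\<close>

text \<open>Domination by 2 |f| |g| \<le> |f|^2 + |g|^2. The factors are kept separate from the
  dominating f and g so that they may also be real or imaginary parts.\<close>

lemma l2_mult_integrable:
  fixes a b :: "'a \<Rightarrow> 'b::{banach,real_normed_algebra,second_countable_topology}"
  assumes f: "f \<in> l2_funs M" and g: "g \<in> l2_funs M"
    and [measurable]: "a \<in> borel_measurable M" "b \<in> borel_measurable M"
    and le: "\<And>x. norm (a x) \<le> norm (f x)" "\<And>x. norm (b x) \<le> norm (g x)"
  shows "integrable M (\<lambda>x. a x * b x)"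
proof (rule Bochner_Integration.integrable_bound)
  show "integrable M (\<lambda>x. (norm (f x))\<^sup>2 + (norm (g x))\<^sup>2)"
    using f g by (auto simp: l2_funs_def)
  show "AE x in M. norm (a x * b x) \<le> norm ((norm (f x))\<^sup>2 + (norm (g x))\<^sup>2)"
  proof (rule AE_I2)
    fix x
    have "norm (a x * b x) \<le> norm (a x) * norm (b x)" by (rule norm_mult_ineq)
    also have "\<dots> \<le> norm (f x) * norm (g x)" by (intro mult_mono le) auto
    also have "\<dots> \<le> 2 * norm (f x) * norm (g x)" by simp
    also have "\<dots> \<le> (norm (f x))\<^sup>2 + (norm (g x))\<^sup>2" by (rule sum_squares_bound)
    finally show "norm (a x * b x) \<le> norm ((norm (f x))\<^sup>2 + (norm (g x))\<^sup>2)" by simp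
  qed
qed measurable

lemma l2_funs_measurable: "f \<in> l2_funs M \<Longrightarrow> f \<in> borel_measurable M"
  by (simp add: l2_funs_def)

lemma cnj_borel_measurable [measurable]: "cnj \<in> borel_measurable borel"
  by (intro borel_measurable_continuous_onI continuous_intros)

lemma l2_mult_cnj_integrable:
  assumes "f \<in> l2_funs M" "g \<in> l2_funs M"
  shows "integrable M (\<lambda>x. f x * cnj (g x))"
proof -
  have [measurable]: "f \<in> borel_measurable M" "g \<in> borel_measurable M"
    using assms by (auto dest: l2_funs_measurable)
  show ?thesis by (rule l2_mult_integrable[OF assms]) auto
qed

lemma (in finite_measure) l2_funs_const: "(\<lambda>_. c) \<in> l2_funs M"
  by (simp add: l2_funs_def)

lemma (in finite_measure) l2_funs_integrable:
  assumes "f \<in> l2_funs M"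
  shows "integrable M f"
proof -
  have "integrable M (\<lambda>x. f x * cnj 1)"
    by (rule l2_mult_cnj_integrable[OF assms l2_funs_const])
  thus ?thesis by simp
qed

text \<open>Constancy on the fibres of \<open>q\<close> holds at every point, as required by
  intersections formed before identification. Every subspace of the theorem has this form for a
  suitable coordinate map.\<close>

definition fib :: "('x \<Rightarrow> 'y) \<Rightarrow> ('x \<Rightarrow> 'z) set" where
  "fib q = {f. \<forall>x y. q x = q y \<longrightarrow> f x = f y}"

section \<open>Conditioning on the sigma-algebra generated by a map\<close>

lemma (in finite_measure) finite_measure_subalgebra_vimage:
  fixes X :: "'a \<Rightarrow> 'b::topological_space"
  assumes "X \<in> borel_measurable M"
  shows "finite_measure_subalgebra M (vimage_algebra (space M) X borel)"
proof
  show "subalgebra M (vimage_algebra (space M) X borel)"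
    using measurable_sets[OF assms]
    by (auto simp: subalgebra_def sets_vimage_algebra2)
qed

text \<open>The condition on events says E[d | X] = 0, and \<open>k\<close> can be pulled out of the
  conditional expectation. This passes from events to functions without approximating
  \<open>k\<close> by simple functions.\<close>

lemma (in finite_measure) integral_mult_zero_of_vimage:
  fixes X :: "'a \<Rightarrow> 'b::topological_space" and d k :: "'a \<Rightarrow> real"
  assumes X: "X \<in> borel_measurable M" and d: "integrable M d"
    and zero: "\<And>B. B \<in> sets borel \<Longrightarrow> (\<integral>x. indicator B (X x) * d x \<partial>M) = 0"
    and k: "k \<in> borel_measurable (vimage_algebra (space M) X borel)"
    and int: "integrable M (\<lambda>x. k x * d x)"
  shows "(\<integral>x. k x * d x \<partial>M) = 0"
proof -
  let ?F = "vimage_algebra (space M) X borel"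
  interpret F: finite_measure_subalgebra M ?F
    by (rule finite_measure_subalgebra_vimage[OF X])
  have "AE x in M. real_cond_exp M ?F d x = 0"
  proof (rule F.real_cond_exp_charact)
    fix A assume "A \<in> sets ?F"
    then obtain B where B: "B \<in> sets borel" "A = X -` B \<inter> space M"
      by (auto simp: sets_vimage_algebra2)
    have "(\<integral>x. indicator A x *\<^sub>R d x \<partial>M) = (\<integral>x. indicator B (X x) * d x \<partial>M)"
      by (rule Bochner_Integration.integral_cong) (auto simp: B indicator_def)
    thus "(\<integral>x\<in>A. d x \<partial>M) = (\<integral>x\<in>A. 0 \<partial>M)"
      using zero[OF B(1)] by (simp add: set_lebesgue_integral_def)
  qed (use d in auto)
  moreover have [measurable]: "k \<in> borel_measurable M"
    by (rule measurable_from_subalg[OF F.subalg k])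
  ultimately have "(\<integral>x. k x * real_cond_exp M ?F d x \<partial>M) = (\<integral>x. 0 \<partial>M)"
    by (intro integral_cong_AE) auto
  thus ?thesis
    using F.real_cond_exp_intg(2)[OF int k] d by auto
qed

lemma fib_comp: "f \<in> fib q \<Longrightarrow> (\<lambda>x. F (f x)) \<in> fib q"
  unfolding fib_def mem_Collect_eq by metis

lemma fib_comp2: "f \<in> fib q \<Longrightarrow> g \<in> fib q \<Longrightarrow> (\<lambda>x. F (f x) (g x)) \<in> fib q"
  unfolding fib_def mem_Collect_eq by metis

text \<open>A representative \<open>h\<close> of the conditional expectation of \<open>f\<close> given \<open>q\<close> that is constant on
  all fibres of \<open>q\<close>.\<close>

definition fib_exp ::
  "'x measure \<Rightarrow> ('x \<Rightarrow> 'y::topological_space) \<Rightarrow> ('x \<Rightarrow> complex) \<Rightarrow> ('x \<Rightarrow> complex) \<Rightarrow> bool" where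
  "fib_exp N q f h \<longleftrightarrow> h \<in> fib q \<and> h \<in> l2_funs N \<and>
     (\<forall>B\<in>sets borel. (\<integral>x. indicator B (q x) *\<^sub>R (f x - h x) \<partial>N) = 0)"

text \<open>The measurable section \<open>s\<close> makes a measurable function that is constant on the fibres of
  \<open>q\<close> a measurable function of \<open>q\<close>.\<close>

locale l2_fibration = prob_space N for N :: "'x::topological_space measure" +
  fixes q :: "'x \<Rightarrow> 'y::topological_space" and s :: "'y \<Rightarrow> 'x"
  assumes sets_N [measurable_cong]: "sets N = sets borel"
    and q_measurable [measurable]: "q \<in> borel_measurable borel"
    and s_measurable [measurable]: "s \<in> borel_measurable borel"
    and q_section: "q (s y) = y"
begin

definition q_algebra :: "'x measure" where
  "q_algebra = vimage_algebra (space N) q borel"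

lemma space_N: "space N = UNIV"
  using sets_eq_imp_space_eq[OF sets_N] by simp

lemma sets_q_algebra: "A \<in> sets q_algebra \<longleftrightarrow> (\<exists>B\<in>sets borel. A = q -` B)"
  by (auto simp: q_algebra_def sets_vimage_algebra2 space_N)

lemma q_measurable_q_algebra [measurable]: "q \<in> borel_measurable q_algebra"
  unfolding q_algebra_def by (rule measurable_vimage_algebra1) simp

sublocale Q: finite_measure_subalgebra N q_algebra
  unfolding q_algebra_def
  by (rule finite_measure_subalgebra_vimage) (simp cong: measurable_cong_sets add: sets_N)

lemma fib_factor:
  assumes "f \<in> fib q"
  shows "f = (\<lambda>x. f (s (q x)))"
proof
  fix x
  show "f x = f (s (q x))"
    using assms q_section[of "q x"] unfolding fib_def mem_Collect_eq by metis
qed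

lemma fib_measurable:
  assumes "f \<in> fib q" "f \<in> borel_measurable N"
  shows "f \<in> borel_measurable q_algebra"
proof -
  have [measurable]: "f \<in> borel_measurable borel"
    using assms(2) by (simp cong: measurable_cong_sets add: sets_N)
  show ?thesis by (subst fib_factor[OF assms(1)]) measurable
qed

text \<open>The level set of f through x lies in the generated sigma-algebra, hence is a full
  preimage under \<open>q\<close> and contains the whole fibre of x.\<close>

lemma measurable_imp_fib:
  fixes f :: "'x \<Rightarrow> real"
  assumes "f \<in> borel_measurable q_algebra"
  shows "f \<in> fib q"
  unfolding fib_def
proof safe
  fix x y assume "q x = q y"
  have "f -` {f x} \<inter> space q_algebra \<in> sets q_algebra"
    by (rule measurable_sets[OF assms]) simp
  then obtain B where "f -` {f x} \<inter> space q_algebra = q -` B"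
    by (auto simp: sets_q_algebra)
  moreover have "space q_algebra = UNIV" by (simp add: q_algebra_def space_N)
  ultimately have "f -` {f x} = q -` B" by simp
  with \<open>q x = q y\<close> show "f x = f y" by (metis vimage_singleton_eq vimage_eq)
qed

text \<open>Real and imaginary parts are conditioned separately. Square-integrability is the
  conditional Jensen inequality for the square, and constancy on fibres comes from
  \<open>measurable_imp_fib\<close>.\<close>

lemma fib_exp_exists:
  assumes f: "f \<in> l2_funs N"
  shows "\<exists>h. fib_exp N q f h"
proof -
  have [measurable]: "f \<in> borel_measurable N" using f by (rule l2_funs_measurable)
  have int: "integrable N f" using f by (rule l2_funs_integrable)
  define a b where "a = real_cond_exp N q_algebra (\<lambda>x. Re (f x))"
    and "b = real_cond_exp N q_algebra (\<lambda>x. Im (f x))"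
  define h where "h = (\<lambda>x. Complex (a x) (b x))"
  have meas: "a \<in> borel_measurable q_algebra" "b \<in> borel_measurable q_algebra"
    by (auto simp: a_def b_def)
  have [measurable]: "a \<in> borel_measurable N" "b \<in> borel_measurable N"
    by (auto simp: a_def b_def)
  have sq: "integrable N (\<lambda>x. (real_cond_exp N q_algebra g x)\<^sup>2)"
    if [measurable]: "g \<in> borel_measurable N" and "\<And>x. \<bar>g x\<bar> \<le> norm (f x)" for g
  proof (rule Q.integrable_convex_cond_exp[where I = UNIV and q = power2])
    show "integrable N g"
      by (rule Bochner_Integration.integrable_bound[OF int]) (use that in auto)
    show "integrable N (\<lambda>x. (g x)\<^sup>2)"
    proof (rule Bochner_Integration.integrable_bound)
      show "integrable N (\<lambda>x. (norm (f x))\<^sup>2)" using f by (simp add: l2_funs_def)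
      have "(g x)\<^sup>2 \<le> (norm (f x))\<^sup>2" for x
        using that(2)[of x] by (simp flip: abs_le_square_iff)
      thus "AE x in N. norm ((g x)\<^sup>2) \<le> norm ((norm (f x))\<^sup>2)" by simp
    qed measurable
    show "convex_on UNIV (power2 :: real \<Rightarrow> real)" by (rule convex_power2)
  qed (auto simp: emeasure_space_1)
  have "integrable N (\<lambda>x. (a x)\<^sup>2 + (b x)\<^sup>2)"
    unfolding a_def b_def
    by (intro Bochner_Integration.integrable_add sq abs_Re_le_cmod abs_Im_le_cmod) auto
  moreover have "h \<in> borel_measurable N"
    by (subst borel_measurable_complex_iff) (simp add: h_def)
  ultimately have h: "h \<in> l2_funs N"
    by (simp add: l2_funs_def h_def cmod_power2)
  have "h \<in> fib q"
    unfolding h_def by (rule fib_comp2[OF measurable_imp_fib[OF meas(1)] measurable_imp_fib[OF meas(2)]])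
  moreover have "(\<integral>x. indicator B (q x) *\<^sub>R (f x - h x) \<partial>N) = 0" if B: "B \<in> sets borel" for B
  proof (rule complex_eqI)
    have A: "q -` B \<in> sets q_algebra" using B by (auto simp: sets_q_algebra)
    hence AN: "q -` B \<in> sets N" using Q.subalg by (auto simp: subalgebra_def)
    have ind: "indicator B (q x) = (indicator (q -` B) x :: real)" for x
      by (simp add: indicator_def)
    have int': "integrable N (\<lambda>x. indicator B (q x) *\<^sub>R g x)"
      if "integrable N g" for g :: "'x \<Rightarrow> 'b::{banach, second_countable_topology}"
      unfolding ind by (rule integrable_mult_indicator[OF AN that])
    have int_d: "integrable N (\<lambda>x. f x - h x)"
      by (intro l2_funs_integrable l2_funs_diff f h)
    have re: "integrable N (\<lambda>x. Re (f x))" "integrable N (\<lambda>x. Im (f x))"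
      using int by auto
    have ab: "integrable N a" "integrable N b"
      using re by (auto simp: a_def b_def)
    have "Re (\<integral>x. indicator B (q x) *\<^sub>R (f x - h x) \<partial>N) =
        (\<integral>x. Re (indicator B (q x) *\<^sub>R (f x - h x)) \<partial>N)"
      by (rule integral_Re[symmetric]) (rule int'[OF int_d])
    also have "\<dots> = (\<integral>x. indicator B (q x) *\<^sub>R Re (f x) - indicator B (q x) *\<^sub>R a x \<partial>N)"
      by (simp add: h_def right_diff_distrib)
    also have "\<dots> = 0"
      using Q.real_cond_exp_intA[OF re(1) A] int'[OF re(1)] int'[OF ab(1)]
      by (simp add: set_lebesgue_integral_def ind a_def)
    finally show "Re (\<integral>x. indicator B (q x) *\<^sub>R (f x - h x) \<partial>N) = Re 0" by simp
    have "Im (\<integral>x. indicator B (q x) *\<^sub>R (f x - h x) \<partial>N) =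
        (\<integral>x. Im (indicator B (q x) *\<^sub>R (f x - h x)) \<partial>N)"
      by (rule integral_Im[symmetric]) (rule int'[OF int_d])
    also have "\<dots> = (\<integral>x. indicator B (q x) *\<^sub>R Im (f x) - indicator B (q x) *\<^sub>R b x \<partial>N)"
      by (simp add: h_def right_diff_distrib)
    also have "\<dots> = 0"
      using Q.real_cond_exp_intA[OF re(2) A] int'[OF re(2)] int'[OF ab(2)]
      by (simp add: set_lebesgue_integral_def ind b_def)
    finally show "Im (\<integral>x. indicator B (q x) *\<^sub>R (f x - h x) \<partial>N) = Im 0" by simp
  qed
  ultimately show ?thesis using h by (auto simp: fib_exp_def)
qed

text \<open>\<open>fib_exp\<close> tests f - h only against events of \<open>q\<close>. A function
  in \<open>fib q\<close> is measurable for \<open>q_algebra\<close>, so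
  \<open>integral_mult_zero_of_vimage\<close> reaches it; that lemma is real, hence the four
  products of real and imaginary parts.\<close>

lemma fib_exp_orthogonal:
  assumes f: "f \<in> l2_funs N" and h: "fib_exp N q f h" and g: "g \<in> fib q" "g \<in> l2_funs N"
  shows "(\<integral>x. (f x - h x) * cnj (g x) \<partial>N) = 0"
proof -
  define d where "d = (\<lambda>x. f x - h x)"
  have d: "d \<in> l2_funs N" using f h by (auto simp: d_def fib_exp_def intro: l2_funs_diff)
  have int: "integrable N d" using d by (rule l2_funs_integrable)
  have [measurable]: "d \<in> borel_measurable N" "g \<in> borel_measurable N"
    using d g by (auto dest: l2_funs_measurable)
  have zero: "(\<integral>x. indicator B (q x) * Re (d x) \<partial>N) = 0"
    "(\<integral>x. indicator B (q x) * Im (d x) \<partial>N) = 0" if B: "B \<in> sets borel" for B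
  proof -
    have "(\<integral>x. indicator B (q x) *\<^sub>R d x \<partial>N) = 0"
      using h B by (auto simp: fib_exp_def d_def)
    moreover have "q -` B \<in> sets N"
      using measurable_sets_borel[OF q_measurable B] by (simp add: sets_N)
    hence "integrable N (\<lambda>x. indicator (q -` B) x *\<^sub>R d x)"
      by (rule integrable_mult_indicator[OF _ int])
    hence "integrable N (\<lambda>x. indicator B (q x) *\<^sub>R d x)"
      by (simp add: indicator_def)
    ultimately show "(\<integral>x. indicator B (q x) * Re (d x) \<partial>N) = 0"
      "(\<integral>x. indicator B (q x) * Im (d x) \<partial>N) = 0"
      using integral_Re[of N "\<lambda>x. indicator B (q x) *\<^sub>R d x"]
        integral_Im[of N "\<lambda>x. indicator B (q x) *\<^sub>R d x"] by simp_all
  qed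
  have orth: "integrable N (\<lambda>x. k x * e x) \<and> (\<integral>x. k x * e x \<partial>N) = 0"
    if [measurable]: "k \<in> borel_measurable N" and k: "k \<in> fib q" "\<And>x. \<bar>k x\<bar> \<le> norm (g x)"
      and e: "integrable N e" "\<And>x. \<bar>e x\<bar> \<le> norm (d x)"
        "\<And>B. B \<in> sets borel \<Longrightarrow> (\<integral>x. indicator B (q x) * e x \<partial>N) = 0"
    for k e :: "'x \<Rightarrow> real"
  proof -
    have i: "integrable N (\<lambda>x. k x * e x)"
      by (rule l2_mult_integrable[OF g(2) d]) (use k e in auto)
    moreover have "k \<in> borel_measurable (vimage_algebra (space N) q borel)"
      using fib_measurable[OF k(1) that(1)] by (simp add: q_algebra_def)
    ultimately show ?thesis
      using integral_mult_zero_of_vimage[OF _ e(1) e(3)] by simp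
  qed
  have fib: "(\<lambda>x. Re (g x)) \<in> fib q" "(\<lambda>x. Im (g x)) \<in> fib q"
    by (rule fib_comp[OF g(1)])+
  have rr: "integrable N (\<lambda>x. Re (g x) * Re (d x)) \<and> (\<integral>x. Re (g x) * Re (d x) \<partial>N) = 0"
    and ri: "integrable N (\<lambda>x. Re (g x) * Im (d x)) \<and> (\<integral>x. Re (g x) * Im (d x) \<partial>N) = 0"
    and ir: "integrable N (\<lambda>x. Im (g x) * Re (d x)) \<and> (\<integral>x. Im (g x) * Re (d x) \<partial>N) = 0"
    and ii: "integrable N (\<lambda>x. Im (g x) * Im (d x)) \<and> (\<integral>x. Im (g x) * Im (d x) \<partial>N) = 0"
    by (rule orth; use fib int zero abs_Re_le_cmod abs_Im_le_cmod in simp)+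
  have i: "integrable N (\<lambda>x. d x * cnj (g x))" by (rule l2_mult_cnj_integrable[OF d g(2)])
  have "(\<integral>x. d x * cnj (g x) \<partial>N) = 0"
  proof (rule complex_eqI)
    have "Re (\<integral>x. d x * cnj (g x) \<partial>N) = (\<integral>x. Re (g x) * Re (d x) + Im (g x) * Im (d x) \<partial>N)"
      unfolding integral_Re[OF i, symmetric] by (simp add: mult.commute)
    thus "Re (\<integral>x. d x * cnj (g x) \<partial>N) = Re 0" using rr ii by simp
    have "Im (\<integral>x. d x * cnj (g x) \<partial>N) = (\<integral>x. Re (g x) * Im (d x) - Im (g x) * Re (d x) \<partial>N)"
      unfolding integral_Im[OF i, symmetric] by (simp add: mult.commute)
    thus "Im (\<integral>x. d x * cnj (g x) \<partial>N) = Im 0" using ri ir by simp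
  qed
  thus ?thesis by (simp add: d_def)
qed

text \<open>Uniqueness: the difference g of two candidates lies in the subspace and is orthogonal to
  f - k and to f - h, hence to g itself. Since any h with \<open>fib_exp\<close> is accepted,
  algebraic properties of the projection can be read off from representatives.\<close>

lemma l2_proj_fib:
  assumes f: "f \<in> l2_funs N" and h: "fib_exp N q f h"
  shows "l2_proj N (l2_sub N (fib q)) (l2_cls N f) = l2_cls N h"
  unfolding l2_proj_def
proof (rule the_equality)
  have hl: "h \<in> fib q" "h \<in> l2_funs N" using h by (auto simp: fib_exp_def)
  show "l2_cls N h \<in> l2_sub N (fib q) \<and>
      (\<forall>Z\<in>l2_sub N (fib q). l2_inner N (l2_diff N (l2_cls N f) (l2_cls N h)) Z = 0)"
    using hl f fib_exp_orthogonal[OF f h]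
    by (auto simp: l2_sub_def l2_diff_cls l2_inner_cls l2_funs_diff)
  fix Y assume Y: "Y \<in> l2_sub N (fib q) \<and>
      (\<forall>Z\<in>l2_sub N (fib q). l2_inner N (l2_diff N (l2_cls N f) Y) Z = 0)"
  then obtain k where k: "k \<in> fib q" "k \<in> l2_funs N" "Y = l2_cls N k"
    by (auto simp: l2_sub_def)
  define g where "g = (\<lambda>x. h x - k x)"
  have g: "g \<in> fib q" "g \<in> l2_funs N"
    unfolding g_def by (rule fib_comp2[OF hl(1) k(1)], rule l2_funs_diff[OF hl(2) k(2)])
  have "l2_inner N (l2_diff N (l2_cls N f) Y) (l2_cls N g) = 0"
    using Y g by (auto simp: l2_sub_def)
  hence 1: "(\<integral>x. (f x - k x) * cnj (g x) \<partial>N) = 0"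
    using k f g by (simp add: l2_diff_cls l2_inner_cls l2_funs_diff)
  have 2: "(\<integral>x. (f x - h x) * cnj (g x) \<partial>N) = 0"
    by (rule fib_exp_orthogonal[OF f h g])
  have "(\<integral>x. complex_of_real ((norm (g x))\<^sup>2) \<partial>N) =
      (\<integral>x. (f x - k x) * cnj (g x) - (f x - h x) * cnj (g x) \<partial>N)"
    unfolding complex_norm_square
    by (rule Bochner_Integration.integral_cong) (simp_all add: g_def algebra_simps)
  also have "\<dots> = 0"
    using 1 2 l2_mult_cnj_integrable[OF l2_funs_diff[OF f k(2)] g(2)]
      l2_mult_cnj_integrable[OF l2_funs_diff[OF f hl(2)] g(2)] by simp
  finally have "(\<integral>x. (norm (g x))\<^sup>2 \<partial>N) = 0"
    by (simp only: integral_complex_of_real of_real_eq_0_iff)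
  hence "AE x in N. (norm (g x))\<^sup>2 = 0"
    using g(2) by (subst (asm) integral_nonneg_eq_0_iff_AE) (auto simp: l2_funs_def)
  hence "AE x in N. k x = h x" by eventually_elim (simp add: g_def)
  thus "Y = l2_cls N h" using k hl by (simp add: l2_cls_eq_iff)
qed

lemma fib_exp_integrable:
  assumes "f \<in> l2_funs N" "fib_exp N q f h" "B \<in> sets borel"
  shows "integrable N (\<lambda>x. indicator B (q x) *\<^sub>R (f x - h x))"
proof -
  have "integrable N (\<lambda>x. f x - h x)"
    using assms by (auto simp: fib_exp_def intro!: l2_funs_integrable l2_funs_diff)
  moreover have "q -` B \<in> sets N"
    using measurable_sets_borel[OF q_measurable assms(3)] by (simp add: sets_N)
  ultimately have "integrable N (\<lambda>x. indicator (q -` B) x *\<^sub>R (f x - h x))"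
    by (intro integrable_mult_indicator)
  thus ?thesis by (simp add: indicator_def)
qed

lemma fib_exp_add:
  assumes "f \<in> l2_funs N" "f' \<in> l2_funs N" "fib_exp N q f h" "fib_exp N q f' h'"
  shows "fib_exp N q (\<lambda>x. f x + f' x) (\<lambda>x. h x + h' x)"
proof -
  have "(\<integral>x. indicator B (q x) *\<^sub>R (f x + f' x - (h x + h' x)) \<partial>N) = 0"
    if B: "B \<in> sets borel" for B
  proof -
    have "(\<integral>x. indicator B (q x) *\<^sub>R (f x + f' x - (h x + h' x)) \<partial>N) =
        (\<integral>x. indicator B (q x) *\<^sub>R (f x - h x) + indicator B (q x) *\<^sub>R (f' x - h' x) \<partial>N)"
      by (intro Bochner_Integration.integral_cong) (auto simp: algebra_simps)
    also have "\<dots> = 0"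
      using fib_exp_integrable[OF assms(1,3) B] fib_exp_integrable[OF assms(2,4) B] assms(3,4) B
      by (simp add: fib_exp_def)
    finally show ?thesis .
  qed
  moreover have "(\<lambda>x. h x + h' x) \<in> fib q"
    using assms(3,4) fib_comp2[of h q h' "(+)"] by (simp add: fib_exp_def)
  ultimately show ?thesis
    using assms(3,4) by (auto simp: fib_exp_def intro: l2_funs_add)
qed

lemma fib_exp_scale:
  assumes "fib_exp N q f h"
  shows "fib_exp N q (\<lambda>x. c * f x) (\<lambda>x. c * h x)"
proof -
  have "(\<integral>x. indicator B (q x) *\<^sub>R (c * f x - c * h x) \<partial>N) =
      (\<integral>x. c * (indicator B (q x) *\<^sub>R (f x - h x)) \<partial>N)" for B
    by (intro Bochner_Integration.integral_cong) (auto simp: algebra_simps)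
  hence "(\<integral>x. indicator B (q x) *\<^sub>R (c * f x - c * h x) \<partial>N) = 0" if "B \<in> sets borel" for B
    using assms that by (simp only: integral_mult_right_zero fib_exp_def mult_zero_right)
  moreover have "(\<lambda>x. c * h x) \<in> fib q"
    using assms fib_comp[of h q "(*) c"] by (simp add: fib_exp_def)
  ultimately show ?thesis
    using assms by (auto simp: fib_exp_def intro: l2_funs_scale)
qed

text \<open>Pythagoras: the cross term integrates to 0 by orthogonality, and |f - h|^2 is dropped
  pointwise.\<close>

lemma fib_exp_norm_le:
  assumes f: "f \<in> l2_funs N" and h: "fib_exp N q f h"
  shows "(\<integral>x. (norm (h x))\<^sup>2 \<partial>N) \<le> (\<integral>x. (norm (f x))\<^sup>2 \<partial>N)"
proof -
  have hl: "h \<in> fib q" "h \<in> l2_funs N" using h by (auto simp: fib_exp_def)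
  have int: "integrable N (\<lambda>x. (f x - h x) * cnj (h x))"
    by (intro l2_mult_cnj_integrable l2_funs_diff f hl)
  have "(\<integral>x. (norm (h x))\<^sup>2 \<partial>N) =
      (\<integral>x. (norm (h x))\<^sup>2 + 2 * Re ((f x - h x) * cnj (h x)) \<partial>N)"
  proof -
    have "(\<integral>x. Re ((f x - h x) * cnj (h x)) \<partial>N) = 0"
      using integral_Re[OF int] fib_exp_orthogonal[OF f h hl] by simp
    thus ?thesis
      using hl(2) integrable_Re[OF int] by (simp add: l2_funs_def del: times_complex.sel)
  qed
  also have "\<dots> \<le> (\<integral>x. (norm (f x))\<^sup>2 \<partial>N)"
  proof (rule integral_mono)
    show "integrable N (\<lambda>x. (norm (h x))\<^sup>2 + 2 * Re ((f x - h x) * cnj (h x)))"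
      using hl(2) integrable_Re[OF int] by (simp add: l2_funs_def del: times_complex.sel)
    fix x
    have "(norm (f x))\<^sup>2 =
        (norm (h x))\<^sup>2 + 2 * Re ((f x - h x) * cnj (h x)) + (norm (f x - h x))\<^sup>2"
      by (simp add: cmod_power2) (simp add: power2_eq_square algebra_simps)
    thus "(norm (h x))\<^sup>2 + 2 * Re ((f x - h x) * cnj (h x)) \<le> (norm (f x))\<^sup>2" by simp
  qed (use f in \<open>auto simp: l2_funs_def\<close>)
  finally show ?thesis .
qed

lemma l2_bounded_map_proj: "l2_bounded_map N N (l2_proj N (l2_sub N (fib q)))"
proof (rule l2_bounded_mapI[where C = 1])
  fix X assume "X \<in> L2 N"
  then obtain f where f: "f \<in> l2_funs N" "X = l2_cls N f" by (rule L2_cases)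
  obtain h where h: "fib_exp N q f h" using fib_exp_exists[OF f(1)] by blast
  have hl: "h \<in> l2_funs N" using h by (simp add: fib_exp_def)
  show "l2_proj N (l2_sub N (fib q)) X \<in> L2 N"
    using f h hl by (simp add: l2_proj_fib l2_cls_in_L2)
  show "l2_norm N (l2_proj N (l2_sub N (fib q)) X) \<le> 1 * l2_norm N X"
    using f h hl by (simp add: l2_proj_fib l2_norm_cls fib_exp_norm_le)
  show "l2_proj N (l2_sub N (fib q)) (l2_scale N c X) =
      l2_scale N c (l2_proj N (l2_sub N (fib q)) X)" for c
    using f hl l2_proj_fib[OF f(1) h] l2_proj_fib[OF l2_funs_scale[OF f(1)] fib_exp_scale[OF h], of c]
    by (simp add: l2_scale_cls)
  fix Y assume "Y \<in> L2 N"
  then obtain f' where f': "f' \<in> l2_funs N" "Y = l2_cls N f'" by (rule L2_cases)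
  obtain h' where h': "fib_exp N q f' h'" using fib_exp_exists[OF f'(1)] by blast
  have hl': "h' \<in> l2_funs N" using h' by (simp add: fib_exp_def)
  show "l2_proj N (l2_sub N (fib q)) (l2_add N X Y) =
      l2_add N (l2_proj N (l2_sub N (fib q)) X) (l2_proj N (l2_sub N (fib q)) Y)"
    unfolding f(2) f'(2) l2_add_cls[OF f(1) f'(1)] l2_proj_fib[OF f(1) h] l2_proj_fib[OF f'(1) h']
      l2_proj_fib[OF l2_funs_add[OF f(1) f'(1)] fib_exp_add[OF f(1) f'(1) h h']]
    by (rule l2_add_cls[OF hl hl', symmetric])
qed

end

section \<open>The mean as a bounded operator\<close>

lemma (in prob_space) l2_bounded_map_mean: "l2_bounded_map M M (l2_mean M)"
proof (rule l2_bounded_mapI[where C = 1])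
  fix X assume "X \<in> L2 M"
  then obtain f where f: "f \<in> l2_funs M" "X = l2_cls M f" by (rule L2_cases)
  have int: "integrable M f" by (rule l2_funs_integrable[OF f(1)])
  show "l2_mean M X \<in> L2 M"
    using f by (simp add: l2_mean_cls l2_cls_in_L2 l2_funs_const)
  show "l2_mean M (l2_scale M c X) = l2_scale M c (l2_mean M X)" for c
    using f int by (simp add: l2_mean_cls l2_scale_cls l2_funs_scale l2_funs_const)
  \<comment> \<open>Nonnegativity of the variance is the Cauchy-Schwarz inequality against the
    constant 1.\<close>
  have "0 \<le> variance (\<lambda>x. norm (f x))" by simp
  also have "\<dots> = expectation (\<lambda>x. (norm (f x))\<^sup>2) - (expectation (\<lambda>x. norm (f x)))\<^sup>2"
    using f(1) int by (intro variance_eq) (auto simp: l2_funs_def)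
  finally have "(expectation (\<lambda>x. norm (f x)))\<^sup>2 \<le> expectation (\<lambda>x. (norm (f x))\<^sup>2)" by simp
  moreover have "(norm (expectation f))\<^sup>2 \<le> (expectation (\<lambda>x. norm (f x)))\<^sup>2"
    by (intro power_mono integral_norm_bound) auto
  ultimately have "norm (expectation f) \<le> sqrt (expectation (\<lambda>x. (norm (f x))\<^sup>2))"
    by (intro real_le_rsqrt) linarith
  thus "l2_norm M (l2_mean M X) \<le> 1 * l2_norm M X"
    using f by (simp add: l2_mean_cls l2_norm_cls l2_funs_const prob_space)
  fix Y assume "Y \<in> L2 M"
  then obtain g where g: "g \<in> l2_funs M" "Y = l2_cls M g" by (rule L2_cases)
  show "l2_mean M (l2_add M X Y) = l2_add M (l2_mean M X) (l2_mean M Y)"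
    using f g int l2_funs_integrable[OF g(1)]
    by (simp add: l2_mean_cls l2_add_cls l2_funs_add l2_funs_const)
qed


section \<open>Conditional independence\<close>

text \<open>This is E[1_A(U) | V, W] = E[1_A(U) | W], tested on events of (V, W). On a rectangle B x
  C, conditional independence splits the conditional expectation, and E[1_B(V) | W] may be replaced
  by 1_B(V) because the remaining factor is W-measurable. Rectangles are stable under intersection
  and generate, so Dynkin's argument covers all D.\<close>

lemma cond_indep_rect:
  fixes U :: "'p \<Rightarrow> 'u::second_countable_topology"
    and V :: "'p \<Rightarrow> 'v::second_countable_topology"
    and W :: "'p \<Rightarrow> 'w::second_countable_topology"
  assumes "prob_space M"
    and U[measurable]: "U \<in> borel_measurable M"
    and V[measurable]: "V \<in> borel_measurable M"
    and W[measurable]: "W \<in> borel_measurable M"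
    and CI: "cond_indep_given M U V W"
    and A[measurable]: "A \<in> sets borel" and D: "D \<in> sets borel"
  shows "(\<integral>\<omega>. indicator D (V \<omega>, W \<omega>) * indicator A (U \<omega>) \<partial>M) =
    (\<integral>\<omega>. indicator D (V \<omega>, W \<omega>) *
      real_cond_exp M (vimage_algebra (space M) W borel) (\<lambda>\<omega>. indicator A (U \<omega>)) \<omega> \<partial>M)"
proof -
  interpret prob_space M by fact
  define G where "G = vimage_algebra (space M) W borel"
  interpret G: finite_measure_subalgebra M G
    unfolding G_def by (rule finite_measure_subalgebra_vimage[OF W])
  have WG [measurable]: "W \<in> borel_measurable G"
    unfolding G_def by (rule measurable_vimage_algebra1) simp
  define e where "e = real_cond_exp M G (\<lambda>\<omega>. indicator A (U \<omega>))"
  have [measurable]: "e \<in> borel_measurable G" "e \<in> borel_measurable M" by (auto simp: e_def)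
  have int_1: "integrable M (\<lambda>\<omega>. indicator B (Y \<omega>) :: real)"
    if [measurable]: "Y \<in> borel_measurable M" "B \<in> sets borel"
    for B and Y :: "'p \<Rightarrow> 'y::topological_space"
    by (rule integrable_const_bound[where B = 1]) auto
  have iA: "integrable M (\<lambda>\<omega>. indicator A (U \<omega>) :: real)"
    by (rule int_1) measurable
  hence int_e: "integrable M e" unfolding e_def by (rule G.real_cond_exp_int(1))
  have int_ind: "integrable M (\<lambda>\<omega>. indicator B (Y \<omega>) * f \<omega>)"
    if "integrable M f" and [measurable]: "Y \<in> borel_measurable M" "B \<in> sets borel"
    for f :: "'p \<Rightarrow> real" and B and Y :: "'p \<Rightarrow> 'y::topological_space"
    by (rule Bochner_Integration.integrable_bound[OF that(1)])
      (use that in \<open>auto simp: indicator_def\<close>)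
  have VW [measurable]: "(\<lambda>\<omega>. (V \<omega>, W \<omega>)) \<in> borel_measurable M"
    by measurable
  note int_VW = int_ind[OF _ VW]
  define P where "P = (\<lambda>D. (\<integral>\<omega>. indicator D (V \<omega>, W \<omega>) * indicator A (U \<omega>) \<partial>M) =
    (\<integral>\<omega>. indicator D (V \<omega>, W \<omega>) * e \<omega> \<partial>M))"
  let ?R = "{B \<times> C |B C. B \<in> sets (borel :: 'v measure) \<and> C \<in> sets (borel :: 'w measure)}"
  have rect: "P (B \<times> C)" if [measurable]: "B \<in> sets borel" "C \<in> sets borel" for B C
  proof -
    let ?eB = "real_cond_exp M G (\<lambda>\<omega>. indicator B (V \<omega>))"
    have ci: "AE \<omega> in M. real_cond_exp M G (\<lambda>\<omega>. indicator A (U \<omega>) * indicator B (V \<omega>)) \<omega> =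
        e \<omega> * ?eB \<omega>"
      using CI that(1) A by (simp add: cond_indep_given_def Let_def e_def flip: G_def)
    have "(\<integral>\<omega>. indicator (B \<times> C) (V \<omega>, W \<omega>) * indicator A (U \<omega>) \<partial>M) =
        ((\<integral>\<omega>. indicator C (W \<omega>) * (indicator A (U \<omega>) * indicator B (V \<omega>)) \<partial>M) :: real)"
      by (simp add: indicator_times mult_ac)
    also have "\<dots> = (\<integral>\<omega>. indicator C (W \<omega>) *
        real_cond_exp M G (\<lambda>\<omega>. indicator A (U \<omega>) * indicator B (V \<omega>)) \<omega> \<partial>M)"
      by (rule G.real_cond_exp_intg(2)[symmetric])
        (auto intro!: int_ind[OF _ W] int_ind[OF _ U] int_1[OF V])
    also have "\<dots> = (\<integral>\<omega>. (indicator C (W \<omega>) * e \<omega>) * ?eB \<omega> \<partial>M)"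
      by (rule integral_cong_AE) (use ci in auto)
    also have "\<dots> = (\<integral>\<omega>. (indicator C (W \<omega>) * e \<omega>) * indicator B (V \<omega>) \<partial>M)"
    proof (rule G.real_cond_exp_intg(2))
      have "integrable M (\<lambda>\<omega>. indicator B (V \<omega>) * (indicator C (W \<omega>) * e \<omega>))"
        by (intro int_ind[OF _ V] int_ind[OF _ W] int_e) auto
      thus "integrable M (\<lambda>\<omega>. indicator C (W \<omega>) * e \<omega> * indicator B (V \<omega>))"
        by (simp add: mult_ac)
    qed auto
    also have "\<dots> = (\<integral>\<omega>. indicator (B \<times> C) (V \<omega>, W \<omega>) * e \<omega> \<partial>M)"
      by (simp add: indicator_times mult_ac)
    finally show ?thesis by (simp add: P_def)
  qed
  have sig: "sigma_sets UNIV ?R = sets (borel :: ('v \<times> 'w) measure)"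
    using sets_pair_measure[of "borel :: 'v measure" "borel :: 'w measure"]
    unfolding borel_prod by simp
  have "Int_stable ?R" by (rule Int_stable_pair_measure_generator)
  moreover have "?R \<subseteq> Pow UNIV" by simp
  moreover have "D \<in> sigma_sets UNIV ?R" using D by (simp add: sig)
  ultimately have "P D"
  proof (induction rule: sigma_sets_induct_disjoint)
    case (basic D)
    thus ?case using rect by blast
  next
    case empty
    show ?case by (simp add: P_def)
  next
    case (compl D)
    hence D: "D \<in> sets borel" by (simp add: sig)
    have "P UNIV" using rect[of UNIV UNIV] by simp
    hence "(\<integral>\<omega>. indicator A (U \<omega>) \<partial>M) - (\<integral>\<omega>. indicator D (V \<omega>, W \<omega>) * indicator A (U \<omega>) \<partial>M) =
      (\<integral>\<omega>. e \<omega> \<partial>M) - (\<integral>\<omega>. indicator D (V \<omega>, W \<omega>) * e \<omega> \<partial>M)"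
      using compl.IH by (simp add: P_def)
    hence "(\<integral>\<omega>. indicator A (U \<omega>) - indicator D (V \<omega>, W \<omega>) * indicator A (U \<omega>) \<partial>M) =
      (\<integral>\<omega>. e \<omega> - indicator D (V \<omega>, W \<omega>) * e \<omega> \<partial>M)"
      using int_VW[OF iA D] int_VW[OF int_e D] int_e iA by simp
    thus ?case by (simp add: P_def indicator_diff left_diff_distrib)
  next
    case (union F)
    have F: "F i \<in> sets borel" for i using union.hyps(2) by (auto simp: sig)
    \<comment> \<open>Countable additivity is obtained from finite disjoint unions by dominated
      convergence, with majorant |f|.\<close>
    have lim: "(\<lambda>n. \<integral>\<omega>. indicator (\<Union>i<n. F i) (V \<omega>, W \<omega>) * f \<omega> \<partial>M) \<longlonglongrightarrow>
        (\<integral>\<omega>. indicator (\<Union>i. F i) (V \<omega>, W \<omega>) * f \<omega> \<partial>M)"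
      if f: "integrable M f" for f :: "'p \<Rightarrow> real"
    proof (rule integral_dominated_convergence[where w = "\<lambda>\<omega>. norm (f \<omega>)"])
      have [measurable]: "f \<in> borel_measurable M" using f by auto
      show "(\<lambda>\<omega>. indicator (\<Union>i. F i) (V \<omega>, W \<omega>) * f \<omega>) \<in> borel_measurable M"
        using int_VW[OF f, of "\<Union>i. F i"] F by auto
      show "(\<lambda>\<omega>. indicator (\<Union>i<n. F i) (V \<omega>, W \<omega>) * f \<omega>) \<in> borel_measurable M" for n
        using int_VW[OF f, of "\<Union>i<n. F i"] F by auto
      show "AE \<omega> in M. (\<lambda>n. indicator (\<Union>i<n. F i) (V \<omega>, W \<omega>) * f \<omega>) \<longlonglongrightarrow>
          indicator (\<Union>i. F i) (V \<omega>, W \<omega>) * f \<omega>"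
        by (intro AE_I2 tendsto_mult_right LIMSEQ_indicator_UN)
    qed (use f in \<open>auto simp: indicator_def\<close>)
    have fin: "(\<integral>\<omega>. indicator (\<Union>i<n. F i) (V \<omega>, W \<omega>) * f \<omega> \<partial>M) =
        (\<Sum>i<n. \<integral>\<omega>. indicator (F i) (V \<omega>, W \<omega>) * f \<omega> \<partial>M)"
      if f: "integrable M f" for f :: "'p \<Rightarrow> real" and n
    proof -
      have "indicator (\<Union>i<n. F i) x = (\<Sum>i<n. indicator (F i) x :: real)" for x
        using union.hyps(1)
        by (subst indicator_UN_disjoint) (auto simp: disjoint_family_on_def)
      thus ?thesis
        by (simp only: sum_distrib_right Bochner_Integration.integral_sum[OF int_VW[OF f F]])
    qed
    have "(\<lambda>n. \<integral>\<omega>. indicator (\<Union>i<n. F i) (V \<omega>, W \<omega>) * indicator A (U \<omega>) \<partial>M) =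
        (\<lambda>n. \<integral>\<omega>. indicator (\<Union>i<n. F i) (V \<omega>, W \<omega>) * e \<omega> \<partial>M)"
      using union.IH unfolding fin[OF iA] fin[OF int_e] P_def by simp
    thus ?case
      using LIMSEQ_unique[OF lim[OF iA]] lim[OF int_e] by (simp add: P_def)
  qed
  thus ?thesis by (simp add: P_def e_def G_def)
qed

text \<open>If b(W) is the conditional expectation of a(U) given W, it is also the one given (V, W).
  With d = a(U) - b(W), I = 1_D(V, W) and c = E[I | W], split I d = a(U) (I - c) - b(W) (I - c) + c
  d; each summand integrates to 0.\<close>

lemma cond_indep_integral_zero:
  fixes U :: "'p \<Rightarrow> 'u::second_countable_topology"
    and V :: "'p \<Rightarrow> 'v::second_countable_topology"
    and W :: "'p \<Rightarrow> 'w::second_countable_topology"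
    and a :: "'u \<Rightarrow> real" and b :: "'w \<Rightarrow> real"
  assumes "prob_space M"
    and U[measurable]: "U \<in> borel_measurable M"
    and V[measurable]: "V \<in> borel_measurable M"
    and W[measurable]: "W \<in> borel_measurable M"
    and CI: "cond_indep_given M U V W"
    and [measurable]: "a \<in> borel_measurable borel" "b \<in> borel_measurable borel"
    and a: "integrable M (\<lambda>\<omega>. a (U \<omega>))" and b: "integrable M (\<lambda>\<omega>. b (W \<omega>))"
    and zero: "\<And>C. C \<in> sets borel \<Longrightarrow> (\<integral>\<omega>. indicator C (W \<omega>) * (a (U \<omega>) - b (W \<omega>)) \<partial>M) = 0"
    and D[measurable]: "D \<in> sets borel"
  shows "(\<integral>\<omega>. indicator D (V \<omega>, W \<omega>) * (a (U \<omega>) - b (W \<omega>)) \<partial>M) = 0"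
proof -
  interpret prob_space M by fact
  define G where "G = vimage_algebra (space M) W borel"
  interpret G: finite_measure_subalgebra M G
    unfolding G_def by (rule finite_measure_subalgebra_vimage[OF W])
  have WG [measurable]: "W \<in> borel_measurable G"
    unfolding G_def by (rule measurable_vimage_algebra1) simp
  define I where "I = (\<lambda>\<omega>. indicator D (V \<omega>, W \<omega>) :: real)"
  define c where "c = real_cond_exp M G I"
  have [measurable]: "I \<in> borel_measurable M" unfolding I_def by measurable
  have int_I: "integrable M I"
    by (rule integrable_const_bound[where B = 1]) (auto simp: I_def)
  have [measurable]: "c \<in> borel_measurable G" "c \<in> borel_measurable M" by (auto simp: c_def)
  have int_c: "integrable M c" using int_I by (auto simp: c_def)
  \<comment> \<open>Conditioning keeps an indicator between 0 and 1, so multiplication by c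
    preserves integrability of a(U), b(W) and d.\<close>
  have c_bound: "AE \<omega> in M. \<bar>c \<omega>\<bar> \<le> 1"
  proof -
    have "AE \<omega> in M. c \<omega> \<le> 1" "AE \<omega> in M. c \<omega> \<ge> 0"
      unfolding c_def
      by (rule G.real_cond_exp_le_c G.real_cond_exp_ge_c; use int_I in \<open>auto simp: I_def indicator_def\<close>)+
    thus ?thesis by eventually_elim auto
  qed
  have int_mc: "integrable M (\<lambda>\<omega>. f \<omega> * c \<omega>)" if "integrable M f" for f
  proof (rule Bochner_Integration.integrable_bound[OF that])
    show "AE \<omega> in M. norm (f \<omega> * c \<omega>) \<le> norm (f \<omega>)"
      using c_bound by eventually_elim (simp add: abs_mult mult_left_le)
  qed (use that in auto)
  have int_mI: "integrable M (\<lambda>\<omega>. f \<omega> * I \<omega>)" if "integrable M f" for f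
    by (rule Bochner_Integration.integrable_bound[OF that])
      (use that in \<open>auto simp: I_def indicator_def\<close>)
  define d where "d = (\<lambda>\<omega>. a (U \<omega>) - b (W \<omega>))"
  have d: "integrable M d" using a b by (simp add: d_def)
  have dc: "(\<integral>\<omega>. c \<omega> * d \<omega> \<partial>M) = 0"
    by (rule integral_mult_zero_of_vimage[OF W d])
      (use zero int_mc[OF d] in \<open>auto simp: d_def mult.commute simp flip: G_def\<close>)
  have bX: "(\<integral>\<omega>. b (W \<omega>) * c \<omega> \<partial>M) = (\<integral>\<omega>. b (W \<omega>) * I \<omega> \<partial>M)"
    unfolding c_def by (rule G.real_cond_exp_intg(2)) (use int_mI[OF b] in auto)
  \<comment> \<open>By conditional independence and self-adjointness of conditional expectation, \<open>I - \<E>[I | W]\<close>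
    is orthogonal to every event in \<open>U\<close>.\<close>
  have aX: "(\<integral>\<omega>. a (U \<omega>) * (I \<omega> - c \<omega>) \<partial>M) = 0"
  proof (rule integral_mult_zero_of_vimage[OF U])
    show "integrable M (\<lambda>\<omega>. I \<omega> - c \<omega>)" using int_I int_c by simp
    show "integrable M (\<lambda>\<omega>. a (U \<omega>) * (I \<omega> - c \<omega>))"
      using int_mI[OF a] int_mc[OF a] by (simp add: right_diff_distrib)
    have [measurable]: "U \<in> borel_measurable (vimage_algebra (space M) U borel)"
      by (rule measurable_vimage_algebra1) simp
    show "(\<lambda>\<omega>. a (U \<omega>)) \<in> borel_measurable (vimage_algebra (space M) U borel)"
      by measurable
    fix A :: "'u set" assume [measurable]: "A \<in> sets borel"
    let ?A = "\<lambda>\<omega>. indicator A (U \<omega>) :: real"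
    have iA: "integrable M ?A"
      by (rule integrable_const_bound[where B = 1]) auto
    have "(\<integral>\<omega>. I \<omega> * ?A \<omega> \<partial>M) = (\<integral>\<omega>. I \<omega> * real_cond_exp M G ?A \<omega> \<partial>M)"
      unfolding I_def G_def by (rule cond_indep_rect[OF assms(1) U V W CI]) auto
    also have "\<dots> = (\<integral>\<omega>. real_cond_exp M G ?A \<omega> * I \<omega> \<partial>M)"
      by (simp add: mult.commute)
    also have "\<dots> = (\<integral>\<omega>. real_cond_exp M G ?A \<omega> * c \<omega> \<partial>M)"
      unfolding c_def
      by (rule G.real_cond_exp_intg(2)[symmetric]) (use int_mI[OF G.real_cond_exp_int(1)[OF iA]] in auto)
    also have "\<dots> = (\<integral>\<omega>. c \<omega> * real_cond_exp M G ?A \<omega> \<partial>M)"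
      by (simp add: mult.commute)
    also have "\<dots> = (\<integral>\<omega>. c \<omega> * ?A \<omega> \<partial>M)"
      by (rule G.real_cond_exp_intg(2)) (use int_mc[OF iA] in \<open>auto simp: mult.commute\<close>)
    finally have "(\<integral>\<omega>. ?A \<omega> * I \<omega> - ?A \<omega> * c \<omega> \<partial>M) = 0"
      using int_mI[OF iA] int_mc[OF iA] by (simp add: mult.commute)
    thus "(\<integral>\<omega>. ?A \<omega> * (I \<omega> - c \<omega>) \<partial>M) = 0" by (simp add: right_diff_distrib)
  qed
  have "(\<integral>\<omega>. I \<omega> * d \<omega> \<partial>M) = (\<integral>\<omega>. a (U \<omega>) * (I \<omega> - c \<omega>) -
      (b (W \<omega>) * I \<omega> - b (W \<omega>) * c \<omega>) + c \<omega> * d \<omega> \<partial>M)"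
    by (rule Bochner_Integration.integral_cong) (simp_all add: d_def algebra_simps)
  also have "\<dots> = (\<integral>\<omega>. a (U \<omega>) * (I \<omega> - c \<omega>) \<partial>M) -
      ((\<integral>\<omega>. b (W \<omega>) * I \<omega> \<partial>M) - (\<integral>\<omega>. b (W \<omega>) * c \<omega> \<partial>M)) + (\<integral>\<omega>. c \<omega> * d \<omega> \<partial>M)"
  proof -
    have "integrable M (\<lambda>\<omega>. a (U \<omega>) * (I \<omega> - c \<omega>))"
      using int_mI[OF a] int_mc[OF a] by (simp add: right_diff_distrib)
    moreover have "integrable M (\<lambda>\<omega>. c \<omega> * d \<omega>)"
      using int_mc[OF d] by (simp add: mult.commute)
    ultimately show ?thesis using int_mI[OF b] int_mc[OF b] by simp
  qed
  also have "\<dots> = 0" using aX bX dc by simp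
  finally show ?thesis by (simp add: I_def d_def)
qed

lemma cond_indep_integral_zero_complex:
  fixes U :: "'p \<Rightarrow> 'u::second_countable_topology"
    and V :: "'p \<Rightarrow> 'v::second_countable_topology"
    and W :: "'p \<Rightarrow> 'w::second_countable_topology"
    and a :: "'u \<Rightarrow> complex" and b :: "'w \<Rightarrow> complex"
  assumes "prob_space M"
    and U[measurable]: "U \<in> borel_measurable M"
    and V[measurable]: "V \<in> borel_measurable M"
    and W[measurable]: "W \<in> borel_measurable M"
    and CI: "cond_indep_given M U V W"
    and [measurable]: "a \<in> borel_measurable borel" "b \<in> borel_measurable borel"
    and a: "integrable M (\<lambda>\<omega>. a (U \<omega>))" and b: "integrable M (\<lambda>\<omega>. b (W \<omega>))"
    and zero: "\<And>C. C \<in> sets borel \<Longrightarrow> (\<integral>\<omega>. indicator C (W \<omega>) *\<^sub>R (a (U \<omega>) - b (W \<omega>)) \<partial>M) = 0"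
    and D[measurable]: "D \<in> sets borel"
  shows "(\<integral>\<omega>. indicator D (V \<omega>, W \<omega>) *\<^sub>R (a (U \<omega>) - b (W \<omega>)) \<partial>M) = 0"
proof -
  have int: "integrable M (\<lambda>\<omega>. indicator C (Y \<omega>) *\<^sub>R (a (U \<omega>) - b (W \<omega>)))"
    if [measurable]: "Y \<in> borel_measurable M" "C \<in> sets borel"
    for C and Y :: "'p \<Rightarrow> 'y::topological_space"
    by (rule Bochner_Integration.integrable_bound[of M "\<lambda>\<omega>. a (U \<omega>) - b (W \<omega>)"])
      (use a b in \<open>auto simp: indicator_def\<close>)
  have VW: "(\<lambda>\<omega>. (V \<omega>, W \<omega>)) \<in> borel_measurable M" by measurable
  have re0: "(\<integral>\<omega>. indicator C (W \<omega>) * (Re (a (U \<omega>)) - Re (b (W \<omega>))) \<partial>M) = 0"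
    and im0: "(\<integral>\<omega>. indicator C (W \<omega>) * (Im (a (U \<omega>)) - Im (b (W \<omega>))) \<partial>M) = 0"
    if C: "C \<in> sets borel" for C
    using integral_Re[OF int[OF W C]] integral_Im[OF int[OF W C]] zero[OF C] by simp_all
  have "(\<integral>\<omega>. indicator D (V \<omega>, W \<omega>) * (Re (a (U \<omega>)) - Re (b (W \<omega>))) \<partial>M) = 0"
    by (rule cond_indep_integral_zero[OF assms(1) U V W CI]) (use a b re0 in auto)
  moreover have "(\<integral>\<omega>. indicator D (V \<omega>, W \<omega>) * (Im (a (U \<omega>)) - Im (b (W \<omega>))) \<partial>M) = 0"
    by (rule cond_indep_integral_zero[OF assms(1) U V W CI]) (use a b im0 in auto)
  ultimately show ?thesis
    using integral_Re[OF int[OF VW D]] integral_Im[OF int[OF VW D]] by (simp add: complex_eq_iff)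
qed


section \<open>Spectra of the alternating projections\<close>

lemma (in l2_fibration) fib_exp_const: "fib_exp N q (\<lambda>_. c) (\<lambda>_. c)"
  by (simp add: fib_exp_def fib_def l2_funs_const)

lemma l2_bounded_map_proj_mean:
  assumes "l2_fibration N q s" "l2_fibration N q' s'"
  shows "l2_bounded_map N N
    (l2_op_diff N (l2_proj N (l2_sub N (fib q')) \<circ> l2_proj N (l2_sub N (fib q))) (l2_mean N))"
proof -
  interpret q: l2_fibration N q s by fact
  interpret q': l2_fibration N q' s' by fact
  show ?thesis
    unfolding l2_op_diff_def[abs_def] o_apply
    by (intro l2_bounded_map_diff l2_bounded_map_comp[OF q.l2_bounded_map_proj]
        q'.l2_bounded_map_proj q.l2_bounded_map_mean)
qed

text \<open>The constants form a nontrivial kernel.\<close>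

lemma zero_in_l2_spectrum_proj_mean:
  assumes "l2_fibration N q s" "l2_fibration N q' s'"
  shows "0 \<in> l2_spectrum N
    (l2_op_diff N (l2_proj N (l2_sub N (fib q')) \<circ> l2_proj N (l2_sub N (fib q))) (l2_mean N))"
    (is "0 \<in> l2_spectrum N ?T")
proof -
  interpret q: l2_fibration N q s by fact
  interpret q': l2_fibration N q' s' by fact
  note const = q.l2_funs_const
  have T: "?T (l2_cls N (\<lambda>_. c)) = l2_cls N (\<lambda>_. 0)" for c
    by (simp add: l2_op_diff_def q.l2_proj_fib[OF const q.fib_exp_const]
        q'.l2_proj_fib[OF const q'.fib_exp_const] l2_mean_cls const l2_diff_cls q.prob_space)
  show ?thesis
  proof (rule l2_spectrum_zero)
    show "l2_cls N (\<lambda>_. 1) \<noteq> l2_cls N (\<lambda>_. 0)"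
      by (simp add: l2_cls_eq_iff const q.AE_False)
  qed (simp_all add: T l2_cls_in_L2 const)
qed

text \<open>Composition with \<open>x \<mapsto> (\<alpha> x, \<beta> x)\<close> intertwines the two operators.\<close>

lemma l2_spectrum_proj_mean_distr:
  fixes \<pi> :: "'x::topological_space measure"
    and \<alpha> :: "'x \<Rightarrow> 'a::second_countable_topology"
    and \<beta> :: "'x \<Rightarrow> 'b::second_countable_topology"
    and \<gamma> :: "'x \<Rightarrow> 'c::topological_space"
  assumes \<alpha>: "l2_fibration \<pi> \<alpha> s\<alpha>" and \<gamma>: "l2_fibration \<pi> \<gamma> s\<gamma>"
    and \<beta>[measurable]: "\<beta> \<in> borel_measurable borel"
    and \<gamma>\<beta>: "\<And>x y. \<gamma> x = \<gamma> y \<Longrightarrow> \<beta> x = \<beta> y"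
    and CI: "\<And>a b D. a \<in> borel_measurable borel \<Longrightarrow> b \<in> borel_measurable borel \<Longrightarrow>
      integrable \<pi> (\<lambda>x. a (\<alpha> x)) \<Longrightarrow> integrable \<pi> (\<lambda>x. b (\<beta> x)) \<Longrightarrow>
      (\<And>C. C \<in> sets borel \<Longrightarrow>
        (\<integral>x. indicator C (\<beta> x) *\<^sub>R (a (\<alpha> x) - b (\<beta> x) :: complex) \<partial>\<pi>) = 0) \<Longrightarrow>
      D \<in> sets borel \<Longrightarrow> (\<integral>x. indicator D (\<gamma> x) *\<^sub>R (a (\<alpha> x) - b (\<beta> x)) \<partial>\<pi>) = 0"
    and N: "N = distr \<pi> borel (\<lambda>x. (\<alpha> x, \<beta> x))"
  shows "l2_spectrum \<pi> (l2_op_diff \<pi>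
      (l2_proj \<pi> (l2_sub \<pi> (fib \<gamma>)) \<circ> l2_proj \<pi> (l2_sub \<pi> (fib \<alpha>))) (l2_mean \<pi>)) =
    l2_spectrum N (l2_op_diff N
      (l2_proj N (l2_sub N (fib snd)) \<circ> l2_proj N (l2_sub N (fib fst))) (l2_mean N))"
    (is "l2_spectrum \<pi> ?T = l2_spectrum N ?T'")
proof -
  interpret \<alpha>: l2_fibration \<pi> \<alpha> s\<alpha> by fact
  interpret \<gamma>: l2_fibration \<pi> \<gamma> s\<gamma> by fact
  \<comment> \<open>The intended cases are \<open>\<alpha>\<close> = U, \<open>\<beta>\<close> = W,
    \<open>\<gamma>\<close> = (V, W), and the same with U and V exchanged. \<open>CI\<close> then
    says that a conditional expectation of a(\<open>\<alpha>\<close>) given \<open>\<beta>\<close>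
    is also one given \<open>\<gamma>\<close>.\<close>
  define p where "p = (\<lambda>x. (\<alpha> x, \<beta> x))"
  have p_borel [measurable]: "p \<in> borel_measurable borel" unfolding p_def by measurable
  have p [measurable]: "p \<in> measurable \<pi> borel"
    using p_borel by (simp cong: measurable_cong_sets add: \<alpha>.sets_N)
  have Np: "N = distr \<pi> borel p" by (simp add: N p_def)
  have sets_N [measurable_cong]: "sets N = sets borel" by (simp add: Np)
  have [measurable]: "(fst :: 'a \<times> 'b \<Rightarrow> 'a) \<in> borel_measurable borel"
    "(snd :: 'a \<times> 'b \<Rightarrow> 'b) \<in> borel_measurable borel"
    "(\<lambda>y. (y, z)) \<in> borel_measurable (borel :: 'a measure)"
    "(\<lambda>z. (y, z)) \<in> borel_measurable (borel :: 'b measure)" for y :: 'a and z :: 'b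
    by (intro borel_measurable_continuous_onI continuous_intros)+
  interpret N: prob_space N unfolding Np by (rule \<alpha>.prob_space_distr[OF p])
  interpret F: l2_fibration N fst "\<lambda>y. (y, undefined)"
    by unfold_locales (auto simp: sets_N)
  interpret S: l2_fibration N snd "\<lambda>z. (undefined, z)"
    by unfold_locales (auto simp: sets_N)
  have integral_N: "(\<integral>y. g y \<partial>N) = (\<integral>x. g (p x) \<partial>\<pi>)"
    if "g \<in> borel_measurable borel" for g :: "'a \<times> 'b \<Rightarrow> 'e::{banach, second_countable_topology}"
    unfolding Np using that by (intro integral_distr p)
  have borel_N: "g \<in> borel_measurable borel" if "g \<in> l2_funs N" for g
    using l2_funs_measurable[OF that] by (simp cong: measurable_cong_sets add: sets_N)
  have l2_N: "g \<in> l2_funs N \<longleftrightarrow> (\<lambda>x. g (p x)) \<in> l2_funs \<pi>"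
    if [measurable]: "g \<in> borel_measurable borel" for g
    unfolding l2_funs_def Np by (simp add: integrable_distr_eq)
  have l2_p: "(\<lambda>x. g (p x)) \<in> l2_funs \<pi>" if "g \<in> l2_funs N" for g
    using that l2_N[OF borel_N[OF that]] by simp
  have \<beta>_fib: "\<beta> \<in> fib \<gamma>" using \<gamma>\<beta> unfolding fib_def by blast
  define J where "J = (\<lambda>Y. l2_cls \<pi> (\<lambda>x. l2_rep Y (p x)))"
  have J_cls: "J (l2_cls N g) = l2_cls \<pi> (\<lambda>x. g (p x))" if g: "g \<in> l2_funs N" for g
  proof -
    \<comment> \<open>N is the image of \<open>\<pi>\<close> under p, so null sets of N pull back to
      null sets and J does not depend on the representative.\<close>
    have "AE x in \<pi>. l2_rep (l2_cls N g) (p x) = g (p x)"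
      using l2_rep_cls(2)[OF g] unfolding Np by (rule AE_distrD[OF p])
    thus ?thesis
      unfolding J_def by (subst l2_cls_eq_iff) (auto intro!: l2_p l2_rep_cls g)
  qed
  have isom: "l2_norm \<pi> (J Y) = l2_norm N Y" if Y: "Y \<in> L2 N" for Y
  proof -
    obtain g where g: "g \<in> l2_funs N" "Y = l2_cls N g" using Y by (rule L2_cases)
    have [measurable]: "g \<in> borel_measurable borel" by (rule borel_N[OF g(1)])
    show ?thesis
      using g integral_N[of "\<lambda>y. (norm (g y))\<^sup>2"] by (simp add: J_cls l2_norm_cls l2_p)
  qed
  have J: "l2_bounded_map N \<pi> J"
  proof (rule l2_bounded_mapI[where C = 1])
    show "J X \<in> L2 \<pi>" if "X \<in> L2 N" for X
      using that by (auto elim!: L2_cases simp: J_cls l2_p l2_cls_in_L2)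
    show "J (l2_add N X Y) = l2_add \<pi> (J X) (J Y)" if "X \<in> L2 N" "Y \<in> L2 N" for X Y
      using that by (auto elim!: L2_cases simp: J_cls l2_p l2_add_cls l2_funs_add)
    show "J (l2_scale N c X) = l2_scale \<pi> c (J X)" if "X \<in> L2 N" for c X
      using that by (auto elim!: L2_cases simp: J_cls l2_p l2_scale_cls l2_funs_scale)
  qed (simp add: isom)
  have inj: "inj_on J (L2 N)"
  proof (rule inj_onI)
    fix X Y assume XY: "X \<in> L2 N" "Y \<in> L2 N" "J X = J Y"
    obtain f g where f: "f \<in> l2_funs N" "X = l2_cls N f" and g: "g \<in> l2_funs N" "Y = l2_cls N g"
      using XY(1,2) by (auto elim!: L2_cases)
    have [measurable]: "f \<in> borel_measurable borel" "g \<in> borel_measurable borel"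
      using borel_N f g by auto
    have "AE x in \<pi>. f (p x) = g (p x)"
      using XY(3) f g by (simp add: J_cls l2_cls_eq_iff l2_p)
    hence "AE y in N. f y = g y" unfolding Np by (subst AE_distr_iff) auto
    thus "X = Y" using f g by (simp add: l2_cls_eq_iff)
  qed
  have fib_exp_\<alpha>: "\<exists>a\<in>borel_measurable borel. fib_exp \<pi> \<alpha> f (\<lambda>x. a (\<alpha> x))"
    if f: "f \<in> l2_funs \<pi>" for f
  proof -
    obtain h where h: "fib_exp \<pi> \<alpha> f h" using \<alpha>.fib_exp_exists[OF f] by blast
    have "h \<in> fib \<alpha>" and hm: "h \<in> l2_funs \<pi>" using h by (auto simp: fib_exp_def)
    from \<alpha>.fib_factor[OF this(1)] have "fib_exp \<pi> \<alpha> f (\<lambda>x. h (s\<alpha> (\<alpha> x)))" using h by simp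
    moreover have [measurable]: "h \<in> borel_measurable borel"
      using l2_funs_measurable[OF hm] by (simp cong: measurable_cong_sets add: \<alpha>.sets_N)
    have "(\<lambda>y. h (s\<alpha> y)) \<in> borel_measurable borel" by measurable
    ultimately show ?thesis by (intro bexI[of _ "\<lambda>y. h (s\<alpha> y)"])
  qed
  \<comment> \<open>The function b is computed on N from the second coordinate alone;
    \<open>CI\<close> then makes the same b serve for \<open>\<gamma>\<close> on
    \<open>\<pi>\<close>.\<close>
  have key: "\<exists>b\<in>borel_measurable borel. fib_exp N snd (\<lambda>y. a (fst y)) (\<lambda>y. b (snd y)) \<and>
      fib_exp \<pi> \<gamma> (\<lambda>x. a (\<alpha> x)) (\<lambda>x. b (\<beta> x))"
    if a [measurable]: "a \<in> borel_measurable borel" and al2: "(\<lambda>x. a (\<alpha> x)) \<in> l2_funs \<pi>" for a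
  proof -
    have "(\<lambda>y. a (fst y)) \<in> l2_funs N" using al2 by (simp add: l2_N p_def)
    then obtain h where h: "fib_exp N snd (\<lambda>y. a (fst y)) h" using S.fib_exp_exists by blast
    define b where "b = (\<lambda>z. h (undefined, z))"
    have "h \<in> fib snd" and hm: "h \<in> l2_funs N" using h by (auto simp: fib_exp_def)
    from S.fib_factor[OF this(1)] have hb: "h = (\<lambda>y. b (snd y))" by (simp add: b_def)
    have [measurable]: "h \<in> borel_measurable borel" by (rule borel_N[OF hm])
    have b [measurable]: "b \<in> borel_measurable borel" unfolding b_def by measurable
    have bl2: "(\<lambda>x. b (\<beta> x)) \<in> l2_funs \<pi>" using l2_p[OF hm] by (simp add: hb p_def)
    have "(\<integral>x. indicator C (\<beta> x) *\<^sub>R (a (\<alpha> x) - b (\<beta> x)) \<partial>\<pi>) = 0"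
      if [measurable]: "C \<in> sets borel" for C
    proof -
      have "(\<integral>x. indicator C (\<beta> x) *\<^sub>R (a (\<alpha> x) - b (\<beta> x)) \<partial>\<pi>) =
          (\<integral>y. indicator C (snd y) *\<^sub>R (a (fst y) - b (snd y)) \<partial>N)"
        by (subst integral_N) (simp_all add: p_def)
      thus ?thesis using h that by (simp add: fib_exp_def hb)
    qed
    hence "(\<integral>x. indicator D (\<gamma> x) *\<^sub>R (a (\<alpha> x) - b (\<beta> x)) \<partial>\<pi>) = 0" if "D \<in> sets borel" for D
      by (intro CI a b \<alpha>.l2_funs_integrable al2 bl2 that)
    hence "fib_exp \<pi> \<gamma> (\<lambda>x. a (\<alpha> x)) (\<lambda>x. b (\<beta> x))"
      using bl2 \<beta>_fib fib_comp[of \<beta> \<gamma> b] by (simp add: fib_exp_def)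
    thus ?thesis using h b by (auto simp: hb)
  qed
  have T_eq: "?T (l2_cls \<pi> f) = l2_cls \<pi> (\<lambda>x. b (\<beta> x) - (\<integral>x. f x \<partial>\<pi>))"
    if "f \<in> l2_funs \<pi>" "fib_exp \<pi> \<alpha> f (\<lambda>x. a (\<alpha> x))" "fib_exp \<pi> \<gamma> (\<lambda>x. a (\<alpha> x)) (\<lambda>x. b (\<beta> x))"
    for f a b
  proof -
    have "(\<lambda>x. a (\<alpha> x)) \<in> l2_funs \<pi>" "(\<lambda>x. b (\<beta> x)) \<in> l2_funs \<pi>"
      using that by (auto simp: fib_exp_def)
    thus ?thesis
      using that by (simp add: l2_op_diff_def \<alpha>.l2_proj_fib \<gamma>.l2_proj_fib l2_mean_cls l2_diff_cls
          \<alpha>.l2_funs_const)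
  qed
  show ?thesis
  proof (rule l2_spectrum_intertwined[OF J isom inj])
    show "l2_bounded_map \<pi> \<pi> ?T" by (rule l2_bounded_map_proj_mean[OF \<alpha> \<gamma>])
    show "l2_bounded_map N N ?T'"
      by (rule l2_bounded_map_proj_mean[OF F.l2_fibration_axioms S.l2_fibration_axioms])
    show "0 \<in> l2_spectrum \<pi> ?T" by (rule zero_in_l2_spectrum_proj_mean[OF \<alpha> \<gamma>])
    show "0 \<in> l2_spectrum N ?T'"
      by (rule zero_in_l2_spectrum_proj_mean[OF F.l2_fibration_axioms S.l2_fibration_axioms])
    \<comment> \<open>The first projection leaves only a function of \<open>\<alpha>\<close>, and
      \<open>key\<close> turns it into one of \<open>\<beta>\<close>. So even an f that does not
      factor through p has its image in the range of J.\<close>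
    show "?T X \<in> J ` L2 N" if X: "X \<in> L2 \<pi>" for X
    proof -
      obtain f where f: "f \<in> l2_funs \<pi>" "X = l2_cls \<pi> f" using X by (rule L2_cases)
      obtain a where a: "a \<in> borel_measurable borel" "fib_exp \<pi> \<alpha> f (\<lambda>x. a (\<alpha> x))"
        using fib_exp_\<alpha>[OF f(1)] by blast
      hence "(\<lambda>x. a (\<alpha> x)) \<in> l2_funs \<pi>" by (simp add: fib_exp_def)
      from key[OF a(1) this] obtain b where b: "fib_exp N snd (\<lambda>y. a (fst y)) (\<lambda>y. b (snd y))"
        "fib_exp \<pi> \<gamma> (\<lambda>x. a (\<alpha> x)) (\<lambda>x. b (\<beta> x))" by blast
      have "(\<lambda>y. b (snd y) - (\<integral>x. f x \<partial>\<pi>)) \<in> l2_funs N"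
        using b(1) by (intro l2_funs_diff N.l2_funs_const) (simp add: fib_exp_def)
      moreover from this have "?T X = J (l2_cls N (\<lambda>y. b (snd y) - (\<integral>x. f x \<partial>\<pi>)))"
        by (simp only: J_cls f(2) T_eq[OF f(1) a(2) b(2)]) (simp add: p_def)
      ultimately show ?thesis by (simp only: image_eqI l2_cls_in_L2)
    qed
    show "?T (J Y) = J (?T' Y)" if Y: "Y \<in> L2 N" for Y
    proof -
      obtain g where g: "g \<in> l2_funs N" "Y = l2_cls N g" using Y by (rule L2_cases)
      have [measurable]: "g \<in> borel_measurable borel" by (rule borel_N[OF g(1)])
      obtain a where a [measurable]: "a \<in> borel_measurable borel"
        and fa: "fib_exp \<pi> \<alpha> (\<lambda>x. g (p x)) (\<lambda>x. a (\<alpha> x))"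
        using fib_exp_\<alpha>[OF l2_p[OF g(1)]] by blast
      hence al2: "(\<lambda>x. a (\<alpha> x)) \<in> l2_funs \<pi>" by (simp add: fib_exp_def)
      from key[OF a al2] obtain b where b: "fib_exp N snd (\<lambda>y. a (fst y)) (\<lambda>y. b (snd y))"
        "fib_exp \<pi> \<gamma> (\<lambda>x. a (\<alpha> x)) (\<lambda>x. b (\<beta> x))" by blast
      have al2': "(\<lambda>y. a (fst y)) \<in> l2_funs N" using al2 by (simp add: l2_N p_def)
      \<comment> \<open>By change of variables the same a is the conditional expectation of g on N,
        so both operators pass through the same a and b.\<close>
      have "(\<integral>y. indicator B (fst y) *\<^sub>R (g y - a (fst y)) \<partial>N) = 0"
        if [measurable]: "B \<in> sets borel" for B
      proof -
        have "(\<integral>y. indicator B (fst y) *\<^sub>R (g y - a (fst y)) \<partial>N) =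
            (\<integral>x. indicator B (\<alpha> x) *\<^sub>R (g (p x) - a (\<alpha> x)) \<partial>\<pi>)"
          by (subst integral_N) (simp_all add: p_def)
        thus ?thesis using fa that by (simp add: fib_exp_def)
      qed
      hence fa': "fib_exp N fst g (\<lambda>y. a (fst y))"
        using al2' by (simp add: fib_exp_def fib_def)
      have bl2': "(\<lambda>y. b (snd y)) \<in> l2_funs N" using b(1) by (simp add: fib_exp_def)
      have "?T' Y = l2_cls N (\<lambda>y. b (snd y) - (\<integral>y. g y \<partial>N))"
        using g al2' bl2' fa' b(1)
        by (simp add: l2_op_diff_def F.l2_proj_fib S.l2_proj_fib l2_mean_cls l2_diff_cls
            N.l2_funs_const)
      hence "J (?T' Y) = l2_cls \<pi> (\<lambda>x. b (\<beta> x) - (\<integral>y. g y \<partial>N))"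
        using bl2' by (simp add: J_cls l2_funs_diff N.l2_funs_const p_def)
      also have "\<dots> = ?T (J Y)"
        using T_eq[OF l2_p[OF g(1)] fa b(2)] g by (simp add: J_cls integral_N)
      finally show ?thesis ..
    qed
  qed
qed

section \<open>Back to the coordinates of the theorem\<close>

text \<open>For the intersections, changing one coordinate at a time joins any two points that share
  the remaining coordinate.\<close>

lemma const_fib:
  "const_u = fib snd"
  "const_v = fib (\<lambda>x. (fst x, snd (snd x)))"
  "const_v \<inter> const_w = fib fst"
  "const_u \<inter> const_w = fib (\<lambda>x. fst (snd x))"
  "const_fst = fib snd"
  "const_snd = fib fst"
proof -
  show "const_v \<inter> const_w = (fib fst :: ('u \<times> 'v \<times> 'w \<Rightarrow> complex) set)"
    unfolding const_v_def const_w_def fib_def by auto metis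
  show "const_u \<inter> const_w = (fib (\<lambda>x. fst (snd x)) :: ('u \<times> 'v \<times> 'w \<Rightarrow> complex) set)"
    unfolding const_u_def const_w_def fib_def by auto metis
qed (auto simp: const_u_def const_v_def const_fst_def const_snd_def fib_def)

lemma cond_indep_given_commute: "cond_indep_given M U V W \<Longrightarrow> cond_indep_given M V U W"
  unfolding cond_indep_given_def Let_def by (simp add: mult.commute)

theorem corollary4p13:
  fixes M :: "'p measure"
    and U :: "'p \<Rightarrow> 'u::polish_space"
    and V :: "'p \<Rightarrow> 'v::polish_space"
    and W :: "'p \<Rightarrow> 'w::polish_space"
    and \<pi> :: "('u \<times> 'v \<times> 'w) measure"
  assumes "prob_space M"
    and "U \<in> borel_measurable M"
    and "V \<in> borel_measurable M"
    and "W \<in> borel_measurable M"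
    and "distr M borel (\<lambda>\<omega>. (U \<omega>, V \<omega>, W \<omega>)) = \<pi>"
    and "cond_indep_given M U V W"
  shows
    "l2_spectrum \<pi>
       (l2_op_diff \<pi>
          (l2_proj \<pi> (l2_sub \<pi> const_u) \<circ> l2_proj \<pi> (l2_sub \<pi> (const_v \<inter> const_w)))
          (l2_mean \<pi>)) =
     l2_spectrum (marginal_uw \<pi>)
       (l2_op_diff (marginal_uw \<pi>)
          (l2_proj (marginal_uw \<pi>) (l2_sub (marginal_uw \<pi>) const_fst) \<circ>
           l2_proj (marginal_uw \<pi>) (l2_sub (marginal_uw \<pi>) const_snd))
          (l2_mean (marginal_uw \<pi>)))
     \<and>
     l2_spectrum \<pi>
       (l2_op_diff \<pi>
          (l2_proj \<pi> (l2_sub \<pi> const_v) \<circ> l2_proj \<pi> (l2_sub \<pi> (const_u \<inter> const_w)))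
          (l2_mean \<pi>)) =
     l2_spectrum (marginal_vw \<pi>)
       (l2_op_diff (marginal_vw \<pi>)
          (l2_proj (marginal_vw \<pi>) (l2_sub (marginal_vw \<pi>) const_fst) \<circ>
           l2_proj (marginal_vw \<pi>) (l2_sub (marginal_vw \<pi>) const_snd))
          (l2_mean (marginal_vw \<pi>)))"
proof -
  interpret prob_space M by fact
  note [measurable] = assms(2-4)
  define X where "X = (\<lambda>\<omega>. (U \<omega>, V \<omega>, W \<omega>))"
  have X [measurable]: "X \<in> borel_measurable M" unfolding X_def by measurable
  have \<pi>: "\<pi> = distr M borel X" using assms(5) by (simp add: X_def)
  interpret \<pi>: prob_space \<pi> unfolding \<pi> by (rule prob_space_distr[OF X])
  \<comment> \<open>The coordinate maps are continuous, and filling the missing coordinates with the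
    fixed point \<open>undefined\<close> gives continuous sections.\<close>
  have fibration: "l2_fibration \<pi> q s"
    if "continuous_on UNIV q" "continuous_on UNIV s" "\<And>y. q (s y) = y"
    for q :: "'u \<times> 'v \<times> 'w \<Rightarrow> 'y::topological_space" and s
    by unfold_locales (use that in \<open>auto simp: \<pi> intro: borel_measurable_continuous_onI\<close>)
  have meas [measurable]: "(fst :: 'u \<times> 'v \<times> 'w \<Rightarrow> _) \<in> borel_measurable borel"
    "(\<lambda>x :: 'u \<times> 'v \<times> 'w. fst (snd x)) \<in> borel_measurable borel"
    "(\<lambda>x :: 'u \<times> 'v \<times> 'w. snd (snd x)) \<in> borel_measurable borel"
    "(snd :: 'u \<times> 'v \<times> 'w \<Rightarrow> _) \<in> borel_measurable borel"
    by (intro borel_measurable_continuous_onI continuous_intros)+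
  have integral_\<pi>: "(\<integral>x. f x \<partial>\<pi>) = (\<integral>\<omega>. f (X \<omega>) \<partial>M)"
    and integrable_\<pi>: "integrable \<pi> f \<longleftrightarrow> integrable M (\<lambda>\<omega>. f (X \<omega>))"
    if [measurable]: "f \<in> borel_measurable borel" for f :: "'u \<times> 'v \<times> 'w \<Rightarrow> complex"
    unfolding \<pi> by (simp_all add: integral_distr integrable_distr_eq)
  have "l2_spectrum \<pi> (l2_op_diff \<pi>
      (l2_proj \<pi> (l2_sub \<pi> (fib snd)) \<circ> l2_proj \<pi> (l2_sub \<pi> (fib fst))) (l2_mean \<pi>)) =
    l2_spectrum (marginal_uw \<pi>) (l2_op_diff (marginal_uw \<pi>)
      (l2_proj (marginal_uw \<pi>) (l2_sub (marginal_uw \<pi>) (fib snd)) \<circ>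
        l2_proj (marginal_uw \<pi>) (l2_sub (marginal_uw \<pi>) (fib fst))) (l2_mean (marginal_uw \<pi>)))"
  proof (rule l2_spectrum_proj_mean_distr[where \<beta> = "\<lambda>x. snd (snd x)"])
    show "l2_fibration \<pi> fst (\<lambda>u. (u, undefined))"
      by (rule fibration) (auto intro!: continuous_intros)
    show "l2_fibration \<pi> snd (\<lambda>y. (undefined, y))"
      by (rule fibration) (auto intro!: continuous_intros)
    show "marginal_uw \<pi> = distr \<pi> borel (\<lambda>x. (fst x, snd (snd x)))"
      by (simp add: marginal_uw_def case_prod_unfold)
    fix a :: "'u \<Rightarrow> complex" and b :: "'w \<Rightarrow> complex" and D :: "('v \<times> 'w) set"
    assume [measurable]: "a \<in> borel_measurable borel" "b \<in> borel_measurable borel"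
      and ab: "integrable \<pi> (\<lambda>x. a (fst x))" "integrable \<pi> (\<lambda>x. b (snd (snd x)))"
      and zero: "\<And>C. C \<in> sets borel \<Longrightarrow>
        (\<integral>x. indicator C (snd (snd x)) *\<^sub>R (a (fst x) - b (snd (snd x)) :: complex) \<partial>\<pi>) = 0"
      and [measurable]: "D \<in> sets borel"
    \<comment> \<open>Conditional independence lives on M, so the test integrals are moved from
      \<open>\<pi>\<close> to M along X and back.\<close>
    have "(\<integral>\<omega>. indicator D (V \<omega>, W \<omega>) *\<^sub>R (a (U \<omega>) - b (W \<omega>)) \<partial>M) = 0"
    proof (rule cond_indep_integral_zero_complex[OF assms(1-4,6)])
      fix C :: "'w set" assume C[measurable]: "C \<in> sets borel"
      show "(\<integral>\<omega>. indicator C (W \<omega>) *\<^sub>R (a (U \<omega>) - b (W \<omega>)) \<partial>M) = 0"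
        using zero[OF C] by (subst (asm) integral_\<pi>) (simp_all add: X_def)
    qed (use ab in \<open>simp_all add: integrable_\<pi> X_def\<close>)
    thus "(\<integral>x. indicator D (snd x) *\<^sub>R (a (fst x) - b (snd (snd x))) \<partial>\<pi>) = 0"
      by (subst integral_\<pi>) (simp_all add: X_def)
  qed (use meas in auto)
  moreover have "l2_spectrum \<pi> (l2_op_diff \<pi>
      (l2_proj \<pi> (l2_sub \<pi> (fib (\<lambda>x. (fst x, snd (snd x))))) \<circ>
        l2_proj \<pi> (l2_sub \<pi> (fib (\<lambda>x. fst (snd x))))) (l2_mean \<pi>)) =
    l2_spectrum (marginal_vw \<pi>) (l2_op_diff (marginal_vw \<pi>)
      (l2_proj (marginal_vw \<pi>) (l2_sub (marginal_vw \<pi>) (fib snd)) \<circ>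
        l2_proj (marginal_vw \<pi>) (l2_sub (marginal_vw \<pi>) (fib fst))) (l2_mean (marginal_vw \<pi>)))"
  proof (rule l2_spectrum_proj_mean_distr[where \<beta> = "\<lambda>x. snd (snd x)"])
    show "l2_fibration \<pi> (\<lambda>x. fst (snd x)) (\<lambda>v. (undefined, v, undefined))"
      by (rule fibration) (auto intro!: continuous_intros)
    show "l2_fibration \<pi> (\<lambda>x. (fst x, snd (snd x))) (\<lambda>y. (fst y, undefined, snd y))"
      by (rule fibration) (auto intro!: continuous_intros)
    show "marginal_vw \<pi> = distr \<pi> borel (\<lambda>x. (fst (snd x), snd (snd x)))"
      by (simp add: marginal_vw_def case_prod_unfold)
    fix a :: "'v \<Rightarrow> complex" and b :: "'w \<Rightarrow> complex" and D :: "('u \<times> 'w) set"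
    assume [measurable]: "a \<in> borel_measurable borel" "b \<in> borel_measurable borel"
      and ab: "integrable \<pi> (\<lambda>x. a (fst (snd x)))" "integrable \<pi> (\<lambda>x. b (snd (snd x)))"
      and zero: "\<And>C. C \<in> sets borel \<Longrightarrow>
        (\<integral>x. indicator C (snd (snd x)) *\<^sub>R (a (fst (snd x)) - b (snd (snd x)) :: complex) \<partial>\<pi>) = 0"
      and [measurable]: "D \<in> sets borel"
    have "(\<integral>\<omega>. indicator D (U \<omega>, W \<omega>) *\<^sub>R (a (V \<omega>) - b (W \<omega>)) \<partial>M) = 0"
    \<comment> \<open>Conditional independence is symmetric, so U and V may exchange roles.\<close>
    proof (rule cond_indep_integral_zero_complex[OF assms(1,3,2,4)
          cond_indep_given_commute[OF assms(6)]])
      fix C :: "'w set" assume C[measurable]: "C \<in> sets borel"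
      show "(\<integral>\<omega>. indicator C (W \<omega>) *\<^sub>R (a (V \<omega>) - b (W \<omega>)) \<partial>M) = 0"
        using zero[OF C] by (subst (asm) integral_\<pi>) (simp_all add: X_def)
    qed (use ab in \<open>simp_all add: integrable_\<pi> X_def\<close>)
    thus "(\<integral>x. indicator D (fst x, snd (snd x)) *\<^sub>R (a (fst (snd x)) - b (snd (snd x))) \<partial>\<pi>) = 0"
      by (subst integral_\<pi>) (simp_all add: X_def)
  qed (use meas in auto)
  \<comment> \<open>Intersections are rewritten first: rewriting \<open>const_u\<close> or
    \<open>const_v\<close> alone would destroy their pattern.\<close>
  ultimately show ?thesis unfolding const_fib(3,4) unfolding const_fib(1,2,5,6) ..
qed

end
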